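(* Let $v,w\ge 0$ be integers with $v+w\ge 5$ and $v$ odd. (1) If $v\le 2w-1$, then $cost\ \mathscr{ON}(v+w,v;4,2)=cost\ \mathscr{ON}(v+w,4)$. (2) If $v\ge 2w+1$, then $$cost\ \mathscr{ON}(v+w,v;4,2)=\binom{v+w}{2}+\left\lceil \frac12\left(\binom{v}{2}-vw+\left\lceil\frac{w}{2}\right\rceil\right)\right\rceil+\delta,$$ where $\delta=1$ if $w=3$ and $v\equiv 3\pmod 4$, and $\delta=0$ otherwise.
   Context: Let $n\ge v\ge 0$ and let $C>C'\ge 1$ be integers. Let $X$ be a set of $n$ vertices, $K_n$ the complete graph on $X$, and $V\subseteq X$ a fixed subset with $|V|=v$; write $w=n-v$. A grooming $N(n,C)$ is a partition of the edge set $E(K_n)$ into (nonempty, not necessarily connected) subgraphs $B_1,\dots,B_\Lambda$ of $K_n$, without isolated vertices, such that $|E(B_k)|\le C$ for all $k$. A grooming $N(n,v;C,C')$ is an $N(n,C)$ in which, moreover, each $B_k$ contains at most $C'$ edges having both ends in $V$. The (drop) cost of a grooming is $\sum_{k=1}^{\Lambda}|V(B_k)|$. $\mathscr{ON}(n,C)$ (respectively $\mathscr{ON}(n,v;C,C')$) denotes a grooming $N(n,C)$ (respectively $N(n,v;C,C')$) of minimum cost, and $cost\ \mathscr{ON}(n,C)$ (respectively $cost\ \mathscr{ON}(n,v;C,C')$) denotes that minimum cost. *)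

theory Defs
  imports Complex_Main "HOL-Library.Disjoint_Sets"
begin

definition complete_edges :: "'a set \<Rightarrow> 'a set set" where
  "complete_edges X = {e. e \<subseteq> X \<and> card e = 2}"

text \<open>
  A subgraph without isolated vertices is determined by its edge set \<open>B\<close>, and its
  vertex set is then \<open>\<Union>B\<close>; so the blocks of a grooming are represented by their edge sets.
\<close>

definition grooming :: "'a set \<Rightarrow> nat \<Rightarrow> 'a set set set \<Rightarrow> bool" where
  "grooming X C P \<longleftrightarrow>
     partition_on (complete_edges X) P \<and> (\<forall>B\<in>P. card B \<le> C)"

definition grooming2 :: "'a set \<Rightarrow> 'a set \<Rightarrow> nat \<Rightarrow> nat \<Rightarrow> 'a set set set \<Rightarrow> bool" where
  "grooming2 X V C C' P \<longleftrightarrow>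
     grooming X C P \<and> (\<forall>B\<in>P. card {e \<in> B. e \<subseteq> V} \<le> C')"

definition grooming_cost :: "'a set set set \<Rightarrow> nat" where
  "grooming_cost P = (\<Sum>B\<in>P. card (\<Union>B))"

definition cost_ON :: "'a set \<Rightarrow> nat \<Rightarrow> nat" where
  "cost_ON X C = (LEAST c. \<exists>P. grooming X C P \<and> grooming_cost P = c)"

definition cost_ON2 :: "'a set \<Rightarrow> 'a set \<Rightarrow> nat \<Rightarrow> nat \<Rightarrow> nat" where
  "cost_ON2 X V C C' = (LEAST c. \<exists>P. grooming2 X V C C' P \<and> grooming_cost P = c)"

text \<open>Groomings exist, so both minima are attained.\<close>

lemma ex_grooming2:
  assumes "C \<ge> 1" "C' \<ge> 1"
  shows "\<exists>P. grooming2 X V C C' P"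
proof
  let ?P = "(\<lambda>e. {e}) ` complete_edges X"
  have part: "partition_on (complete_edges X) ?P"
    by (rule partition_onI) (auto simp: disjnt_def)
  have small: "card {e' \<in> {e}. e' \<subseteq> V} \<le> C'" for e :: "'a set"
  proof -
    have "card {e' \<in> {e}. e' \<subseteq> V} \<le> card {e}"
      by (rule card_mono) blast+
    also have "\<dots> \<le> C'"
      using assms(2) by simp
    finally show ?thesis .
  qed
  show "grooming2 X V C C' ?P"
    unfolding grooming2_def grooming_def ball_simps(9)
    using part small assms(1) by simp
qed

lemma cost_ON2_attained:
  assumes "C \<ge> 1" "C' \<ge> 1"
  shows "\<exists>P. grooming2 X V C C' P \<and> grooming_cost P = cost_ON2 X V C C'"
  unfolding cost_ON2_def by (rule LeastI_ex) (use ex_grooming2[OF assms] in blast)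

lemma cost_ON_attained:
  assumes "C \<ge> 1"
  shows "\<exists>P. grooming X C P \<and> grooming_cost P = cost_ON X C"
proof -
  obtain P where "grooming X C P"
    using ex_grooming2[OF assms order_refl] unfolding grooming2_def by blast
  then show ?thesis
    unfolding cost_ON_def by - (rule LeastI[of _ "grooming_cost P"], blast)
qed

end

theory Submission
  imports Defs
begin

text \<open>
  A graph with at most four edges has at least as many vertices as edges, so the cost is at least
  \<open>\<bar>E(K\<^sub>n)\<bar>\<close>, and the excess is caused by tree components. Write \<open>e\<^sub>V\<close>, \<open>e\<^sub>X\<close> for the numbers of edges of a
  block inside \<open>V\<close> and between \<open>V\<close> and \<open>W\<close>. In every block twice the excess plus \<open>e\<^sub>X - e\<^sub>V\<close> is at least
  half the number of vertices of \<open>W\<close> that have odd degree towards \<open>V\<close> in the block; since \<open>v\<close> is odd,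
  every vertex of \<open>W\<close> is such a vertex for some block, and summation gives the lower bound. For
  \<open>w = 3\<close> the three edges inside \<open>W\<close> double the last contribution, which after rounding matters only
  if \<open>v\<close> is congruent to 3 modulo 4.

  For the upper bound write \<open>V = Y \<union> {h}\<close> with \<open>\<bar>Y\<bar> = 2 m\<close> and decompose \<open>K\<^sub>Y\<close> into \<open>m\<close> zigzag
  Hamiltonian paths. The first, third, fifth, \<dots> edges of a path form a perfect matching of \<open>Y\<close>, so
  joining \<open>x \<in> W\<close> to these edges gives triangles that use up all edges between \<open>x\<close> and \<open>Y\<close>, and
  each remaining edge of the path is hung on one of the triangles. A triangle with a pendant edge has
  excess 0. The paths that are left over are cut into cherries of excess 1; what remains lives on
  \<open>W \<union> {h}\<close> and a star at \<open>h\<close>. For \<open>v \<le> 2 w - 1\<close> it suffices to treat the largest possible \<open>V\<close>.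
\<close>

section \<open>Lower bounds\<close>

lemma finite_complete_edges: "finite X \<Longrightarrow> finite (complete_edges X)"
  unfolding complete_edges_def by (rule finite_subset[of _ "Pow X"]) auto

lemma card_complete_edges: "finite X \<Longrightarrow> card (complete_edges X) = card X choose 2"
  unfolding complete_edges_def using n_subsets by blast

lemma sum_card_filter_partition_on:
  assumes "partition_on A P" "finite A"
  shows "(\<Sum>B\<in>P. card {e \<in> B. Q e}) = card {e \<in> A. Q e}"
proof -
  have U: "A = \<Union>P" and fin: "finite P" and d: "disjoint P"
    using assms finite_elements partition_onD1 partition_onD2 by blast+
  have "card (\<Union>B\<in>P. {e \<in> B. Q e}) = (\<Sum>B\<in>P. card {e \<in> B. Q e})"
  proof (rule card_UN_disjoint[OF fin])
    show "\<forall>B\<in>P. finite {e \<in> B. Q e}"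
      using assms(2) U by (auto intro: finite_subset)
    show "\<forall>B\<in>P. \<forall>B'\<in>P. B \<noteq> B' \<longrightarrow> {e \<in> B. Q e} \<inter> {e \<in> B'. Q e} = {}"
      using d unfolding disjoint_def by blast
  qed
  moreover have "(\<Union>B\<in>P. {e \<in> B. Q e}) = {e \<in> A. Q e}" using U by auto
  ultimately show ?thesis by simp
qed

lemma choose_two_Suc: "Suc n choose 2 = n + (n choose 2)"
  by (simp add: numeral_2_eq_2)

lemma two_times_choose_two: "2 * (n choose 2) = n * (n - 1)"
  by (induction n) (auto simp: choose_two_Suc algebra_simps)

text \<open>With \<open>k\<close> read as a number of edges and \<open>n\<close> as a number of
  vertices: in a simple graph two edges need a third vertex and four edges a fourth.\<close>

lemma le_choose_two_small:
  assumes "k \<le> n choose 2"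
  shows "1 \<le> k \<Longrightarrow> 2 \<le> n" "2 \<le> k \<Longrightarrow> 3 \<le> n" "4 \<le> k \<Longrightarrow> 4 \<le> n"
proof -
  show "2 \<le> n" if "1 \<le> k" using assms that by (metis binomial_eq_0 le_zero_eq not_less not_one_le_zero)
  show "3 \<le> n" if "2 \<le> k"
  proof (rule ccontr)
    assume "\<not> 3 \<le> n" then have "n = 0 \<or> n = 1 \<or> n = 2" by linarith
    then show False using assms that by (auto simp: choose_two)
  qed
  show "4 \<le> n" if "4 \<le> k"
  proof (rule ccontr)
    assume "\<not> 4 \<le> n" then have "n = 0 \<or> n = 1 \<or> n = 2 \<or> n = 3" by linarith
    then show False using assms that by (auto simp: choose_two)
  qed
qed

text \<open>The block inequality of the overview, doubled and with the negative terms moved across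
  so that it lives in the naturals. Here \<open>a\<close> and \<open>b\<close> count the vertices in
  \<open>V\<close> and \<open>W\<close>, and \<open>k\<close> the odd ends. The two sharper variants
  serve the case \<open>w = 3\<close>.\<close>

lemma block_weight:
  fixes a b eV eW eX k :: nat
  assumes "eV \<le> 2" and e4: "eV + eW + eX \<le> 4"
    and eV: "eV \<le> a choose 2" and eW: "eW \<le> b choose 2"
    and n: "eV + eW + eX \<le> (a + b) choose 2"
    and E: "eX = 0 \<or> a \<noteq> 0" "k \<le> b" "k \<le> eX" and par: "even k \<longleftrightarrow> even eX"
  shows "k + 4 * (eV + eW + eX) + 2 * eV \<le> 4 * (a + b) + 2 * eX"
    and "eW \<le> 2 \<Longrightarrow> 2 * eW + 4 * (eV + eW + eX) + 2 * eV \<le> 4 * (a + b) + 2 * eX"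
    and "eW = 0 \<or> eW = 3 \<Longrightarrow> 2 * k + 4 * (eV + eW + eX) + 2 * eV \<le> 4 * (a + b) + 2 * eX"
proof -
  have V: "1 \<le> eV \<longrightarrow> 2 \<le> a" "2 \<le> eV \<longrightarrow> 3 \<le> a" and W: "1 \<le> eW \<longrightarrow> 2 \<le> b" "2 \<le> eW \<longrightarrow> 3 \<le> b"
    using le_choose_two_small[OF eV] le_choose_two_small[OF eW] by blast+
  have N: "eV + eW + eX \<le> a + b" using le_choose_two_small[OF n] e4 by linarith
  \<comment> \<open>Least numbers of vertices that the edge numbers force; together with
    \<open>N\<close> they settle each of the finitely many triples below by linear
    arithmetic.\<close>
  have a: "(if eV = 2 then 3 else if eV = 1 then 2 else if eX = 0 then 0 else 1) \<le> a"
    using V E(1) assms(1) by auto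
  have b: "(if 2 \<le> eW then 3 else if eW = 1 then 2 else k) \<le> b"
    using W E(2) by auto
  \<comment> \<open>As \<open>eX \<le> 4\<close>, parity turns \<open>k \<le> eX\<close> into three
    equations.\<close>
  have k: "k = eX \<or> k + 2 = eX \<or> k + 4 = eX" using E(3) par e4 by presburger
  have "eV = 0 \<or> eV = 1 \<or> eV = 2" "eX = 0 \<or> eX = 1 \<or> eX = 2 \<or> eX = 3 \<or> eX = 4"
    "eW = 0 \<or> eW = 1 \<or> eW = 2 \<or> eW = 3 \<or> eW = 4"
    using assms(1) e4 by linarith+
  with e4 have "(eV, eX, eW) \<in> set [(i, j, l). i \<leftarrow> [0..<3], j \<leftarrow> [0..<5], l \<leftarrow> [0..<5], i + j + l \<le> 4]"
    by (elim disjE) (simp_all add: upt_rec numeral_eq_Suc)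
  then have "k + 4 * (eV + eW + eX) + 2 * eV \<le> 4 * (a + b) + 2 * eX \<and>
    (eW \<le> 2 \<longrightarrow> 2 * eW + 4 * (eV + eW + eX) + 2 * eV \<le> 4 * (a + b) + 2 * eX) \<and>
    (eW = 0 \<or> eW = 3 \<longrightarrow> 2 * k + 4 * (eV + eW + eX) + 2 * eV \<le> 4 * (a + b) + 2 * eX)"
    using k a b N E(2) by (auto simp: upt_rec numeral_eq_Suc split: if_splits)
  then show "k + 4 * (eV + eW + eX) + 2 * eV \<le> 4 * (a + b) + 2 * eX"
    and "eW \<le> 2 \<Longrightarrow> 2 * eW + 4 * (eV + eW + eX) + 2 * eV \<le> 4 * (a + b) + 2 * eX"
    and "eW = 0 \<or> eW = 3 \<Longrightarrow> 2 * k + 4 * (eV + eW + eX) + 2 * eV \<le> 4 * (a + b) + 2 * eX"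
    by blast+
qed

section \<open>Odd ends and the defect of a block\<close>

definition cross_degree :: "'a set \<Rightarrow> 'a set set \<Rightarrow> 'a \<Rightarrow> nat" where
  "cross_degree W B x = card {e \<in> B. x \<in> e \<and> \<not> e \<subseteq> W}"

definition odd_ends :: "'a set \<Rightarrow> 'a set set \<Rightarrow> 'a set" where
  "odd_ends W B = {x \<in> W. odd (cross_degree W B x)}"

definition cross_edges :: "'a set \<Rightarrow> 'a set \<Rightarrow> 'a set set \<Rightarrow> 'a set set" where
  "cross_edges V W B = {e \<in> B. \<not> e \<subseteq> V \<and> \<not> e \<subseteq> W}"

locale two_parts =
  fixes V W :: "'a set"
  assumes finV: "finite V" and finW: "finite W" and disj: "V \<inter> W = {}"
begin

lemma sum_cross_degree:
  assumes "B \<subseteq> complete_edges (V \<union> W)"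
  shows "(\<Sum>x\<in>W. cross_degree W B x) = card (cross_edges V W B)"
proof -
  have finB: "finite B"
    by (rule finite_subset[OF assms]) (simp add: finite_complete_edges finV finW)
  have "card (\<Union>x\<in>W. {e \<in> B. x \<in> e \<and> \<not> e \<subseteq> W}) = (\<Sum>x\<in>W. cross_degree W B x)"
    unfolding cross_degree_def
  proof (rule card_UN_disjoint[OF finW])
    show "\<forall>x\<in>W. finite {e \<in> B. x \<in> e \<and> \<not> e \<subseteq> W}" using finB by simp
    \<comment> \<open>An edge counted at two vertices of \<open>W\<close> would lie inside
      \<open>W\<close>, so each cross edge is counted once.\<close>
    have "e \<subseteq> W" if "e \<in> B" "x \<in> e" "y \<in> e" "x \<in> W" "y \<in> W" "x \<noteq> y" for e x y
    proof -
      have "card e = 2" using that(1) assms by (auto simp: complete_edges_def)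
      then have "e = {x, y}" using that by (auto simp: card_2_iff)
      then show ?thesis using that by simp
    qed
    then show "\<forall>x\<in>W. \<forall>y\<in>W. x \<noteq> y \<longrightarrow>
      {e \<in> B. x \<in> e \<and> \<not> e \<subseteq> W} \<inter> {e \<in> B. y \<in> e \<and> \<not> e \<subseteq> W} = {}" by blast
  qed
  moreover have "(\<Union>x\<in>W. {e \<in> B. x \<in> e \<and> \<not> e \<subseteq> W}) = cross_edges V W B"
  proof -
    have "e \<subseteq> V \<union> W" if "e \<in> B" for e using that assms by (auto simp: complete_edges_def)
    then show ?thesis using disj unfolding cross_edges_def by fast
  qed
  ultimately show ?thesis by simp
qed

lemma card_edges_split:
  assumes "B \<subseteq> complete_edges (V \<union> W)"
  shows "card B = card {e \<in> B. e \<subseteq> V} + card {e \<in> B. e \<subseteq> W} + card (cross_edges V W B)"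
proof -
  have finB: "finite B"
    by (rule finite_subset[OF assms]) (simp add: finite_complete_edges finV finW)
  have ne: "\<not> (e \<subseteq> V \<and> e \<subseteq> W)" if "e \<in> B" for e
  proof -
    have "e \<noteq> {}" using that assms by (auto simp: complete_edges_def)
    then show ?thesis using disj by blast
  qed
  have "card B = card ({e \<in> B. e \<subseteq> V} \<union> {e \<in> B. e \<subseteq> W} \<union> cross_edges V W B)"
    by (rule arg_cong[of _ _ card]) (auto simp: cross_edges_def)
  also have "\<dots> = card ({e \<in> B. e \<subseteq> V} \<union> {e \<in> B. e \<subseteq> W}) + card (cross_edges V W B)"
    by (rule card_Un_disjoint) (auto simp: cross_edges_def finB)
  also have "card ({e \<in> B. e \<subseteq> V} \<union> {e \<in> B. e \<subseteq> W}) = card {e \<in> B. e \<subseteq> V} + card {e \<in> B. e \<subseteq> W}"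
    by (rule card_Un_disjoint) (use ne finB in auto)
  finally show ?thesis .
qed

text \<open>Every odd end has cross degree at least 1, and the cross degrees add up to the number of
  cross edges; modulo 2 only the odd ends contribute to this sum.\<close>

lemma card_odd_ends_le_cross:
  assumes "B \<subseteq> complete_edges (V \<union> W)"
  shows "card (odd_ends W B) \<le> card (cross_edges V W B)"
    and "even (card (odd_ends W B)) \<longleftrightarrow> even (card (cross_edges V W B))"
proof -
  have "card (odd_ends W B) = (\<Sum>x\<in>odd_ends W B. 1)" by simp
  also have "\<dots> \<le> (\<Sum>x\<in>odd_ends W B. cross_degree W B x)"
    using odd_pos by (intro sum_mono) (fastforce simp: odd_ends_def Suc_le_eq)
  also have "\<dots> \<le> (\<Sum>x\<in>W. cross_degree W B x)"
    by (rule sum_mono2) (auto simp: odd_ends_def finW)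
  finally show "card (odd_ends W B) \<le> card (cross_edges V W B)"
    using sum_cross_degree[OF assms] by simp
  show "even (card (odd_ends W B)) \<longleftrightarrow> even (card (cross_edges V W B))"
    using even_sum_iff[OF finW, of "cross_degree W B"] sum_cross_degree[OF assms]
    by (simp add: odd_ends_def)
qed

lemma card_cross_edges_complete:
  "card (cross_edges V W (complete_edges (V \<union> W))) = card V * card W"
  and cross_degree_complete: "x \<in> W \<Longrightarrow> cross_degree W (complete_edges (V \<union> W)) x = card V"
proof -
  have *: "cross_degree W (complete_edges (V \<union> W)) x = card V" if "x \<in> W" for x
  proof -
    have "{e \<in> complete_edges (V \<union> W). x \<in> e \<and> \<not> e \<subseteq> W} = (\<lambda>y. {x, y}) ` V" (is "?L = ?R")
    proof
      show "?L \<subseteq> ?R"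
      proof
        fix e assume e: "e \<in> ?L"
        then obtain y where "y \<in> e" "y \<notin> W" by auto
        moreover from this e have "y \<in> V" "e = {x, y}"
          using \<open>x \<in> W\<close> by (auto simp: complete_edges_def card_2_iff)
        ultimately show "e \<in> ?R" by auto
      qed
      show "?R \<subseteq> ?L" using that disj by (auto simp: complete_edges_def card_insert_if)
    qed
    moreover have "inj_on (\<lambda>y. {x, y}) V" by (auto simp: inj_on_def doubleton_eq_iff)
    ultimately show ?thesis by (simp add: cross_degree_def card_image)
  qed
  then show "x \<in> W \<Longrightarrow> cross_degree W (complete_edges (V \<union> W)) x = card V" for x .
  show "card (cross_edges V W (complete_edges (V \<union> W))) = card V * card W"
    using sum_cross_degree[OF order_refl] * by (simp add: mult.commute)
qed

text \<open>Supplies the hypotheses of \<open>block_weight\<close> for an actual block.\<close>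

lemma block_shape:
  assumes "B \<subseteq> complete_edges (V \<union> W)"
  defines "a \<equiv> card (\<Union>B \<inter> V)" and "b \<equiv> card (\<Union>B \<inter> W)"
  shows "card (\<Union>B) = a + b"
    and "card {e \<in> B. e \<subseteq> V} \<le> a choose 2"
    and "card {e \<in> B. e \<subseteq> W} \<le> b choose 2"
    and "card B \<le> (a + b) choose 2"
    and "card (cross_edges V W B) = 0 \<or> a \<noteq> 0"
    and "card (odd_ends W B) \<le> b"
proof -
  have sub: "\<Union>B \<subseteq> V \<union> W" using assms(1) by (auto simp: complete_edges_def)
  then have finU: "finite (\<Union>B)" using finV finW finite_subset by blast
  have "card (\<Union>B) = card ((\<Union>B \<inter> V) \<union> (\<Union>B \<inter> W))"
    by (rule arg_cong[of _ _ card]) (use sub in blast)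
  also have "\<dots> = a + b"
    unfolding a_def b_def by (rule card_Un_disjoint) (use finU disj in auto)
  finally show U: "card (\<Union>B) = a + b" .
  have le: "card {e \<in> B. e \<subseteq> Z} \<le> card (\<Union>B \<inter> Z) choose 2" for Z
  proof -
    have "card {e \<in> B. e \<subseteq> Z} \<le> card (complete_edges (\<Union>B \<inter> Z))"
      by (rule card_mono) (use assms(1) finU in \<open>auto simp: complete_edges_def intro: finite_complete_edges[unfolded complete_edges_def]\<close>)
    then show ?thesis using finU by (simp add: card_complete_edges)
  qed
  show "card {e \<in> B. e \<subseteq> V} \<le> a choose 2" "card {e \<in> B. e \<subseteq> W} \<le> b choose 2"
    using le by (simp_all add: a_def b_def)
  have "{e \<in> B. e \<subseteq> V \<union> W} = B" "\<Union>B \<inter> (V \<union> W) = \<Union>B" using sub by blast+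
  then show "card B \<le> (a + b) choose 2" using le[of "V \<union> W"] U by simp
  show "card (cross_edges V W B) = 0 \<or> a \<noteq> 0"
  proof (cases "cross_edges V W B = {}")
    case False
    then obtain e where "e \<in> cross_edges V W B" by blast
    then obtain x where "x \<in> \<Union>B \<inter> V"
      using assms(1) by (auto simp: cross_edges_def complete_edges_def)
    then show ?thesis using finU by (auto simp: a_def)
  qed simp
  have "odd_ends W B \<subseteq> \<Union>B \<inter> W"
  proof
    fix x assume x: "x \<in> odd_ends W B"
    then have "odd (cross_degree W B x)" by (simp add: odd_ends_def)
    then have "cross_degree W B x \<noteq> 0" by (metis even_zero)
    then have "{e \<in> B. x \<in> e \<and> \<not> e \<subseteq> W} \<noteq> {}" unfolding cross_degree_def by (metis card.empty)
    with x show "x \<in> \<Union>B \<inter> W" by (auto simp: odd_ends_def)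
  qed
  then show "card (odd_ends W B) \<le> b" unfolding b_def using finU by (intro card_mono) auto
qed

text \<open>Four times the excess of the block plus twice the difference between its cross edges and
  its edges inside \<open>V\<close>. The type \<open>int\<close> avoids truncated
  subtraction.\<close>

definition block_defect :: "'a set set \<Rightarrow> int" where
  "block_defect B = 4 * int (card (\<Union>B)) + 2 * int (card (cross_edges V W B))
     - 4 * int (card B) - 2 * int (card {e \<in> B. e \<subseteq> V})"

lemma block_defect_ge:
  assumes B: "B \<subseteq> complete_edges (V \<union> W)" and "card B \<le> 4" and "card {e \<in> B. e \<subseteq> V} \<le> 2"
  shows "int (card (odd_ends W B)) \<le> block_defect B"
    and "card {e \<in> B. e \<subseteq> W} \<le> 2 \<Longrightarrow> 2 * int (card {e \<in> B. e \<subseteq> W}) \<le> block_defect B"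
    and "card {e \<in> B. e \<subseteq> W} = 0 \<or> card {e \<in> B. e \<subseteq> W} = 3
      \<Longrightarrow> 2 * int (card (odd_ends W B)) \<le> block_defect B"
proof -
  note shape = block_shape[OF B]
  note split = card_edges_split[OF B]
  note odd = card_odd_ends_le_cross[OF B]
  note bw = block_weight[OF assms(3) _ shape(2,3) _ shape(5) shape(6) odd, folded split]
  note bw' = bw[OF assms(2) shape(4)]
  show "int (card (odd_ends W B)) \<le> block_defect B"
    using bw'(1) unfolding block_defect_def shape(1) by simp
  show "2 * int (card {e \<in> B. e \<subseteq> W}) \<le> block_defect B" if "card {e \<in> B. e \<subseteq> W} \<le> 2"
    using bw'(2)[OF that] unfolding block_defect_def shape(1) by simp
  show "2 * int (card (odd_ends W B)) \<le> block_defect B"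
    if "card {e \<in> B. e \<subseteq> W} = 0 \<or> card {e \<in> B. e \<subseteq> W} = 3"
    using bw'(3)[OF that] unfolding block_defect_def shape(1) by simp
qed

context
  fixes P
  assumes P: "grooming2 (V \<union> W) V 4 2 P"
begin

lemma P_partition: "partition_on (complete_edges (V \<union> W)) P"
  and P_block: "B \<in> P \<Longrightarrow> B \<subseteq> complete_edges (V \<union> W)"
  and P_card: "B \<in> P \<Longrightarrow> card B \<le> 4"
  and P_card_V: "B \<in> P \<Longrightarrow> card {e \<in> B. e \<subseteq> V} \<le> 2"
  and P_finite: "finite P"
proof -
  show *: "partition_on (complete_edges (V \<union> W)) P"
    and "B \<in> P \<Longrightarrow> card B \<le> 4" and "B \<in> P \<Longrightarrow> card {e \<in> B. e \<subseteq> V} \<le> 2"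
    using P by (auto simp: grooming2_def grooming_def)
  show "B \<in> P \<Longrightarrow> B \<subseteq> complete_edges (V \<union> W)" using partition_onD1[OF *] by blast
  show "finite P" using finite_elements[OF _ *] finV finW finite_complete_edges by blast
qed

lemma sum_filter_P:
  "(\<Sum>B\<in>P. card {e \<in> B. Q e}) = card {e \<in> complete_edges (V \<union> W). Q e}"
  using sum_card_filter_partition_on[OF P_partition] finV finW finite_complete_edges by blast

lemma card_inside_complete:
  assumes "Z \<subseteq> V \<union> W"
  shows "card {e \<in> complete_edges (V \<union> W). e \<subseteq> Z} = card Z choose 2"
proof -
  have "{e \<in> complete_edges (V \<union> W). e \<subseteq> Z} = complete_edges Z"
    using assms by (auto simp: complete_edges_def)
  then show ?thesis using assms finV finW by (metis card_complete_edges finite_UnI finite_subset)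
qed

text \<open>The number of edges of each kind is fixed by \<open>V\<close> and \<open>W\<close>, so
  the total defect depends on the grooming through its cost only. Lower bounds for defects thus
  become lower bounds for the cost.\<close>

lemma sum_block_defect:
  "(\<Sum>B\<in>P. block_defect B) =
     4 * (int (grooming_cost P) - int ((card V + card W) choose 2))
     + 2 * int (card V) * int (card W) - 2 * int (card V choose 2)"
proof -
  have "(\<Sum>B\<in>P. card B) = (card V + card W) choose 2"
    using sum_filter_P[of "\<lambda>_. True"] finV finW disj by (simp add: card_complete_edges card_Un_disjoint)
  moreover have "(\<Sum>B\<in>P. card (cross_edges V W B)) = card V * card W"
    unfolding cross_edges_def sum_filter_P
    using card_cross_edges_complete by (simp add: cross_edges_def)
  moreover have "(\<Sum>B\<in>P. card {e \<in> B. e \<subseteq> V}) = card V choose 2"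
    unfolding sum_filter_P by (rule card_inside_complete) simp
  ultimately show ?thesis
    unfolding block_defect_def sum_subtractf sum.distrib sum_distrib_left[symmetric] of_nat_sum[symmetric]
      grooming_cost_def by simp
qed

text \<open>The cross degrees of a vertex of \<open>W\<close> add up to \<open>card V\<close> over
  all blocks; as this is odd, the vertex is an odd end of some block.\<close>

lemma card_le_sum_odd_ends:
  assumes "odd (card V)"
  shows "card W \<le> (\<Sum>B\<in>P. card (odd_ends W B))"
proof -
  have "W \<subseteq> (\<Union>B\<in>P. odd_ends W B)"
  proof
    fix x assume x: "x \<in> W"
    then have "odd (\<Sum>B\<in>P. cross_degree W B x)"
      using assms cross_degree_complete[OF x] unfolding cross_degree_def sum_filter_P by simp
    then obtain B where "B \<in> P" "odd (cross_degree W B x)" by (metis dvd_sum)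
    with x show "x \<in> (\<Union>B\<in>P. odd_ends W B)" by (auto simp: odd_ends_def)
  qed
  then have "card W \<le> card (\<Union>B\<in>P. odd_ends W B)"
    by (intro card_mono) (auto simp: P_finite odd_ends_def finW)
  also have "\<dots> \<le> (\<Sum>B\<in>P. card (odd_ends W B))" by (rule card_UN_le[OF P_finite])
  finally show ?thesis .
qed

lemma grooming_cost_lower:
  assumes "odd (card V)"
  shows "4 * int ((card V + card W) choose 2) + 2 * int (card V choose 2) + int (card W)
    \<le> 4 * int (grooming_cost P) + 2 * int (card V) * int (card W)"
proof -
  have "int (card W) \<le> (\<Sum>B\<in>P. int (card (odd_ends W B)))"
    using card_le_sum_odd_ends[OF assms] by (simp flip: of_nat_sum)
  also have "\<dots> \<le> (\<Sum>B\<in>P. block_defect B)"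
    by (intro sum_mono block_defect_ge(1) P_block P_card P_card_V)
  finally show ?thesis using sum_block_defect by (simp add: algebra_simps)
qed

text \<open>If the three edges inside \<open>W\<close> lie in one block, then every block has defect at least
  twice its number of odd ends; otherwise at least twice its number of edges inside \<open>W\<close>.\<close>

lemma grooming_cost_lower_three:
  assumes "odd (card V)" "card W = 3"
  shows "4 * int ((card V + 3) choose 2) + 2 * int (card V choose 2) + 6
    \<le> 4 * int (grooming_cost P) + 6 * int (card V)"
proof -
  let ?eW = "\<lambda>B. card {e \<in> B. e \<subseteq> W}"
  have eW: "(\<Sum>B\<in>P. ?eW B) = 3"
    unfolding sum_filter_P using card_inside_complete[of W] assms(2) by (simp add: choose_two)
  have "6 \<le> (\<Sum>B\<in>P. block_defect B)"
  proof (cases "\<exists>B\<in>P. ?eW B \<ge> 3")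
    case True
    then obtain B where B: "B \<in> P" "?eW B \<ge> 3" by blast
    \<comment> \<open>All three edges inside \<open>W\<close> lie in \<open>B\<close>, hence none in
      another block.\<close>
    have sum: "(\<Sum>B'\<in>P - {B}. ?eW B') + ?eW B = 3"
      using eW B(1) P_finite by (simp add: sum.remove[of P B])
    have "?eW B' = 0 \<or> ?eW B' = 3" if "B' \<in> P" for B'
    proof (cases "B' = B")
      case True
      moreover have "?eW B = 3" using sum B(2) by linarith
      ultimately show ?thesis by simp
    next
      case False
      then have "?eW B' \<le> (\<Sum>B'\<in>P - {B}. ?eW B')"
        using that P_finite by (intro member_le_sum) auto
      then show ?thesis using sum B(2) by linarith
    qed
    then have "(\<Sum>B\<in>P. 2 * int (card (odd_ends W B))) \<le> (\<Sum>B\<in>P. block_defect B)"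
      by (intro sum_mono block_defect_ge(3) P_block P_card P_card_V)
    then show ?thesis
      using card_le_sum_odd_ends[OF assms(1)] assms(2)
      by (simp flip: sum_distrib_left of_nat_sum)
  next
    case False
    then have "(\<Sum>B\<in>P. 2 * int (?eW B)) \<le> (\<Sum>B\<in>P. block_defect B)"
      by (intro sum_mono block_defect_ge(2) P_block P_card P_card_V) force+
    then show ?thesis using eW by (simp flip: sum_distrib_left of_nat_sum)
  qed
  then show ?thesis using sum_block_defect assms(2) by simp
qed

end

end

text \<open>Two or three edges need three vertices, and a fourth edge forces a fourth vertex. Five
  edges would already fit on four vertices.\<close>

lemma card_edges_le_card_vertices:
  assumes "finite X" "B \<subseteq> complete_edges X" "card B \<le> 4"
  shows "card B \<le> card (\<Union>B)"
proof -
  have "\<Union>B \<subseteq> X" using assms(2) by (auto simp: complete_edges_def)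
  then have fin: "finite (\<Union>B)" using assms(1) finite_subset by blast
  have "card B \<le> card (complete_edges (\<Union>B))"
    by (rule card_mono) (use assms(2) finite_complete_edges[OF fin] in \<open>auto simp: complete_edges_def\<close>)
  then have "card B \<le> card (\<Union>B) choose 2" using card_complete_edges[OF fin] by simp
  from le_choose_two_small[OF this] show ?thesis using assms(3) by linarith
qed

lemma choose_two_le_grooming_cost:
  assumes "finite X" "grooming X 4 P"
  shows "card X choose 2 \<le> grooming_cost P"
proof -
  have part: "partition_on (complete_edges X) P" using assms(2) by (simp add: grooming_def)
  have "card X choose 2 = (\<Sum>B\<in>P. card {e \<in> B. True})"
    using sum_card_filter_partition_on[OF part, of "\<lambda>_. True"] assms(1)
    by (simp add: finite_complete_edges card_complete_edges)
  also have "\<dots> \<le> grooming_cost P"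
    unfolding grooming_cost_def using assms partition_onD1[OF part]
    by (intro sum_mono) (auto simp: grooming_def intro!: card_edges_le_card_vertices)
  finally show ?thesis .
qed

lemma choose_two_le_cost_ON:
  assumes "finite X"
  shows "card X choose 2 \<le> cost_ON X 4"
  using cost_ON_attained[of 4 X] choose_two_le_grooming_cost[OF assms] by force

lemma cost_ON_le_cost_ON2:
  assumes "C \<ge> 1" "C' \<ge> 1"
  shows "cost_ON X C \<le> cost_ON2 X V C C'"
proof -
  obtain P where P: "grooming2 X V C C' P" "grooming_cost P = cost_ON2 X V C C'"
    using cost_ON2_attained[OF assms] by blast
  then have "grooming X C P" by (simp add: grooming2_def)
  then show ?thesis unfolding cost_ON_def P(2)[symmetric] by (intro Least_le) blast
qed

section \<open>Covers\<close>

text \<open>Unlike the blocks of a grooming, the blocks of a cover may share edges; by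
  \<open>cost_ON2_le_of_covers\<close> the overlaps can be removed at no cost, so that no disjointness
  has to be checked in the constructions.\<close>

definition covers :: "nat \<Rightarrow> nat \<Rightarrow> 'a set \<Rightarrow> 'a set set \<Rightarrow> nat \<Rightarrow> bool" where
  "covers C C' V E c \<longleftrightarrow>
     (\<exists>P. finite P \<and> E \<subseteq> \<Union>P \<and>
        (\<forall>B\<in>P. finite B \<and> finite (\<Union>B) \<and> card B \<le> C \<and> card {e \<in> B. e \<subseteq> V} \<le> C') \<and>
        (\<Sum>B\<in>P. card (\<Union>B)) \<le> c)"

lemma covers_mono:
  assumes "covers C C' V E c" "E' \<subseteq> E" "c \<le> c'"
  shows "covers C C' V E' c'"
  using assms unfolding covers_def by (meson order_trans)

text \<open>A larger \<open>V\<close> is the stronger restriction, so a cover built for an enlarged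
  \<open>V\<close> serves the original one.\<close>

lemma covers_superset:
  assumes "covers C C' V' E c" "V \<subseteq> V'"
  shows "covers C C' V E c"
proof -
  obtain P where P: "finite P" "E \<subseteq> \<Union>P" "(\<Sum>B\<in>P. card (\<Union>B)) \<le> c"
    "\<forall>B\<in>P. finite B \<and> finite (\<Union>B) \<and> card B \<le> C \<and> card {e \<in> B. e \<subseteq> V'} \<le> C'"
    using assms(1) unfolding covers_def by blast
  have "card {e \<in> B. e \<subseteq> V} \<le> C'" if "B \<in> P" for B
  proof -
    have "card {e \<in> B. e \<subseteq> V} \<le> card {e \<in> B. e \<subseteq> V'}"
      by (rule card_mono) (use that P(4) assms(2) in auto)
    then show ?thesis using that P(4) by fastforce
  qed
  then show ?thesis unfolding covers_def using P by blast
qed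

text \<open>The vertex set is only bounded by \<open>S\<close>, so constructions may name vertices
  without proving them distinct.\<close>

lemma covers_block:
  assumes "finite B" "\<Union>B \<subseteq> S" "finite S" "card S \<le> c" "card B \<le> C" "card {e \<in> B. e \<subseteq> V} \<le> C'"
  shows "covers C C' V B c"
proof -
  have "card (\<Union>B) \<le> c" using assms(2-4) by (meson card_mono le_trans)
  then show ?thesis
    unfolding covers_def using assms finite_subset by (intro exI[of _ "{B}"]) auto
qed

lemma covers_Un:
  assumes "covers C C' V E c" "covers C C' V E' c'"
  shows "covers C C' V (E \<union> E') (c + c')"
proof -
  obtain P where P: "finite P" "E \<subseteq> \<Union>P" "(\<Sum>B\<in>P. card (\<Union>B)) \<le> c"
    "\<forall>B\<in>P. finite B \<and> finite (\<Union>B) \<and> card B \<le> C \<and> card {e \<in> B. e \<subseteq> V} \<le> C'"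
    using assms(1) unfolding covers_def by blast
  obtain Q where Q: "finite Q" "E' \<subseteq> \<Union>Q" "(\<Sum>B\<in>Q. card (\<Union>B)) \<le> c'"
    "\<forall>B\<in>Q. finite B \<and> finite (\<Union>B) \<and> card B \<le> C \<and> card {e \<in> B. e \<subseteq> V} \<le> C'"
    using assms(2) unfolding covers_def by blast
  \<comment> \<open>A block common to \<open>P\<close> and \<open>Q\<close> is counted once on the
    left, which only lowers the cost.\<close>
  have "(\<Sum>B\<in>P \<union> Q. card (\<Union>B)) \<le> c + c'"
    using sum.union_inter[OF P(1) Q(1), of "\<lambda>B. card (\<Union>B)"] P(3) Q(3) by linarith
  then show ?thesis
    unfolding covers_def using P Q by (intro exI[of _ "P \<union> Q"]) auto
qed

lemma covers_empty: "covers C C' V {} 0"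
  unfolding covers_def by (rule exI[of _ "{}"]) simp

lemma covers_UN:
  assumes "finite I" "\<And>i. i \<in> I \<Longrightarrow> covers C C' V (E i) (c i)"
  shows "covers C C' V (\<Union>i\<in>I. E i) (\<Sum>i\<in>I. c i)"
  using assms
proof (induction I rule: finite_induct)
  case empty
  then show ?case by (simp add: covers_empty)
next
  case (insert i I)
  then show ?case using covers_Un[of C C' V "E i" "c i"] by simp
qed

lemma covers_UN_const:
  assumes "finite I" "\<And>i. i \<in> I \<Longrightarrow> covers C C' V (E i) c"
  shows "covers C C' V (\<Union>i\<in>I. E i) (card I * c)"
  using covers_UN[of I C C' V E "\<lambda>_. c"] assms by simp

lemma covers_UN_lessThan:
  assumes "\<And>i. i < n \<Longrightarrow> covers C C' V (E i) c"
  shows "covers C C' V (\<Union>i<n. E i) (n * c)"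
  using covers_UN[of "{..<n}" C C' V E "\<lambda>_. c"] assms by simp

text \<open>Every edge chooses one block containing it, and the fibres of this choice are the blocks
  of the grooming. A fibre is part of its block, so its edges, its edges inside \<open>V\<close> and
  its vertices can only become fewer.\<close>

lemma cost_ON2_le_of_covers:
  assumes "finite X" "covers C C' V (complete_edges X) c"
  shows "cost_ON2 X V C C' \<le> c"
proof -
  let ?E = "complete_edges X"
  obtain P where P: "finite P" "?E \<subseteq> \<Union>P" "(\<Sum>B\<in>P. card (\<Union>B)) \<le> c"
    "\<forall>B\<in>P. finite B \<and> finite (\<Union>B) \<and> card B \<le> C \<and> card {e \<in> B. e \<subseteq> V} \<le> C'"
    using assms(2) unfolding covers_def by blast
  have "\<forall>e\<in>?E. \<exists>B\<in>P. e \<in> B" using P(2) by blast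
  then obtain f where f: "\<And>e. e \<in> ?E \<Longrightarrow> f e \<in> P \<and> e \<in> f e" by metis
  let ?F = "\<lambda>B. {e \<in> ?E. f e = B}"
  \<comment> \<open>Only chosen blocks are taken, so no part of the partition is empty.\<close>
  let ?Q = "?F ` (f ` ?E)"
  have sub: "?F B \<subseteq> B" for B using f by blast
  have inP: "f ` ?E \<subseteq> P" using f by blast
  have "partition_on ?E ?Q"
    by (rule partition_onI) (auto simp: disjnt_def)
  moreover have "card (?F B) \<le> C" "card {e \<in> ?F B. e \<subseteq> V} \<le> C'" if "B \<in> P" for B
  proof -
    have B: "finite B" "card B \<le> C" "card {e \<in> B. e \<subseteq> V} \<le> C'" using that P(4) by auto
    show "card (?F B) \<le> C" using card_mono[OF B(1) sub] B(2) by linarith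
    have "card {e \<in> ?F B. e \<subseteq> V} \<le> card {e \<in> B. e \<subseteq> V}"
      by (rule card_mono) (use B(1) sub in auto)
    then show "card {e \<in> ?F B. e \<subseteq> V} \<le> C'" using B(3) by linarith
  qed
  ultimately have "grooming2 X V C C' ?Q"
    unfolding grooming2_def grooming_def using inP by blast
  moreover have "grooming_cost ?Q \<le> c"
  proof -
    have fin: "finite (f ` ?E)" using inP P(1) finite_subset by blast
    have "grooming_cost ?Q \<le> (\<Sum>B\<in>f ` ?E. card (\<Union>(?F B)))"
      unfolding grooming_cost_def using sum_image_le[OF fin, of "\<lambda>D. card (\<Union>D)" ?F] by (simp add: o_def)
    also have "\<dots> \<le> (\<Sum>B\<in>f ` ?E. card (\<Union>B))"
      using inP P(4) sub by (intro sum_mono card_mono) blast+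
    also have "\<dots> \<le> (\<Sum>B\<in>P. card (\<Union>B))"
      using inP P(1) by (intro sum_mono2) auto
    finally show ?thesis using P(3) by linarith
  qed
  ultimately show ?thesis
    unfolding cost_ON2_def by (intro order_trans[OF Least_le]) blast+
qed

text \<open>For \<open>h \<in> S\<close> the image also contains the singleton \<open>{h}\<close>;
  this is harmless in a cover and spares the hypothesis \<open>h \<notin> S\<close>.\<close>

definition star :: "'a \<Rightarrow> 'a set \<Rightarrow> 'a set set" where
  "star h S = (\<lambda>x. {h, x}) ` S"

lemma star_empty [simp]: "star h {} = {}"
  and star_insert [simp]: "star h (insert x S) = insert {h, x} (star h S)"
  and star_Un: "star h (S \<union> T) = star h S \<union> star h T"
  by (auto simp: star_def)

lemma star_singleton_flip: "star x {y} = star y {x}"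
  by (simp add: insert_commute)

lemma star_subsetI: "(\<And>x. x \<in> S \<Longrightarrow> {h, x} \<in> K) \<Longrightarrow> star h S \<subseteq> K"
  unfolding star_def by (rule image_subsetI)

lemma in_star: "x \<in> S \<Longrightarrow> {h, x} \<in> star h S"
  by (simp add: star_def)

lemma complete_edges_Un:
  "complete_edges (A \<union> B) \<subseteq> complete_edges A \<union> complete_edges B \<union> (\<Union>x\<in>A. star x B)"
proof
  fix e assume "e \<in> complete_edges (A \<union> B)"
  then have e: "card e = 2" "e \<subseteq> A \<union> B" by (simp_all add: complete_edges_def)
  then obtain x y where xy: "e = {x, y}" using card_2_iff[of e] by blast
  have "{x, y} \<in> star x B" if "y \<in> B" using that by (rule in_star)
  moreover have "{x, y} \<in> star y B" if "x \<in> B" using in_star[OF that, of y] by (simp only: insert_commute)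
  ultimately show "e \<in> complete_edges A \<union> complete_edges B \<union> (\<Union>x\<in>A. star x B)"
    using e(2) e(1)[unfolded xy] unfolding complete_edges_def xy Un_iff UN_iff mem_Collect_eq insert_subset
    by blast
qed

lemma complete_edges_Un_subset:
  "complete_edges A \<subseteq> R \<Longrightarrow> complete_edges B \<subseteq> R \<Longrightarrow> (\<And>x. x \<in> A \<Longrightarrow> star x B \<subseteq> R)
    \<Longrightarrow> complete_edges (A \<union> B) \<subseteq> R"
  by (rule order_trans[OF complete_edges_Un]) (simp add: UN_least)

lemma complete_edges_insert: "complete_edges (insert h T) \<subseteq> star h T \<union> complete_edges T"
proof -
  have "\<not> (e \<subseteq> {h} \<and> card e = 2)" for e
    using card_mono[of "{h}" e] by fastforce
  then have "complete_edges {h} = {}" by (simp add: complete_edges_def)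
  then show ?thesis using complete_edges_Un[of "{h}" T] by (simp add: Un_commute)
qed

lemma complete_edges_insert_subset:
  "star h T \<subseteq> K \<Longrightarrow> complete_edges T \<subseteq> K \<Longrightarrow> complete_edges (insert h T) \<subseteq> K"
  by (rule order_trans[OF complete_edges_insert]) simp

lemma complete_edges_mono: "A \<subseteq> B \<Longrightarrow> complete_edges A \<subseteq> complete_edges B"
  unfolding complete_edges_def by blast

lemma complete_edges_empty [simp]: "complete_edges {} = {}"
  by (simp add: complete_edges_def)

section \<open>Blocks of small excess and graphs built from them\<close>

lemma covers_edges:
  assumes "\<not> e1 \<subseteq> V" "\<not> e2 \<subseteq> V" "e1 \<union> e2 \<union> e3 \<union> e4 \<subseteq> S" "finite S" "card S \<le> c"
  shows "covers 4 2 V {e1, e2, e3, e4} c"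
proof (rule covers_block)
  \<comment> \<open>The first two edges leave \<open>V\<close>, so only \<open>e3\<close> and
    \<open>e4\<close> can count. The four edges may coincide.\<close>
  have "card {e \<in> {e1, e2, e3, e4}. e \<subseteq> V} \<le> card {e3, e4}"
    by (rule card_mono) (use assms in auto)
  then show "card {e \<in> {e1, e2, e3, e4}. e \<subseteq> V} \<le> 2"
    using card_insert_le_m1[of 2 "{e4}" e3] by simp
  show "card {e1, e2, e3, e4} \<le> 4" by (simp add: card_insert_if)
  show "\<Union> {e1, e2, e3, e4} \<subseteq> S" using assms by auto
qed (use assms in auto)

lemma card_le_four: "card {p, q, r, s} \<le> 4" and card_le_three: "card {p, q, r} \<le> 3"
  by (simp_all add: card_insert_if)

lemma covers_cherry: "covers 4 2 V {{p, q}, {q, r}} 3"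
proof (rule covers_block)
  have "card {e \<in> {{p, q}, {q, r}}. e \<subseteq> V} \<le> card {{p, q}, {q, r}}"
    by (rule card_mono) auto
  moreover have "card {{p, q}, {q, r}} \<le> 2" by (simp add: card_insert_if)
  ultimately show "card {e \<in> {{p, q}, {q, r}}. e \<subseteq> V} \<le> 2" "card {{p, q}, {q, r}} \<le> 4"
    by linarith+
  show "card {p, q, r} \<le> 3" by (rule card_le_three)
qed auto

lemma covers_triangle:
  assumes "p \<notin> V"
  shows "covers 4 2 V {{p, q}, {p, r}, {q, r}} 3"
  using covers_edges[of "{p, q}" V "{p, r}" "{q, r}" "{q, r}" "{p, q, r}" 3] assms card_le_three[of p q r]
  by simp

text \<open>A triangle with a pendant edge at any of its corners has four edges on four vertices,
  hence excess 0. The two edges from \<open>p\<close> to \<open>q\<close> and \<open>r\<close> leave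
  \<open>V\<close>, wherever the pendant edge lies.\<close>

lemma covers_paw:
  assumes "p \<notin> V" "u = p \<or> u = q \<or> u = r"
  shows "covers 4 2 V {{p, q}, {p, r}, {q, r}, {u, s}} 4"
  by (rule covers_edges[of _ _ _ _ _ "{p, q, r, s}"]) (use assms in \<open>auto simp: card_le_four\<close>)

text \<open>Distributes a set over two capacities. If the capacities add up to
  \<open>card S\<close>, the two bounds become equalities, which several callers use.\<close>

lemma split_card:
  assumes "finite S" "card S \<le> i + j"
  obtains A B where "S = A \<union> B" "card A \<le> i" "card B \<le> j" "card S = card A + card B"
    "finite A" "finite B"
proof -
  obtain A where A: "A \<subseteq> S" "card A = min i (card S)" using obtain_subset_with_card_n[of "min i (card S)" S] by auto
  have fin: "finite A" using A assms finite_subset by blast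
  have "card (S - A) = card S - card A" using A fin by (simp add: card_Diff_subset)
  with A fin assms show ?thesis by (intro that[of A "S - A"]) auto
qed

lemma covers_small_star:
  assumes "finite A" "finite B" "card A \<le> 2" "card B \<le> 2" "B \<inter> V = {}"
  shows "covers 4 2 V (star h (A \<union> B)) (card A + card B + 1)"
proof (rule covers_block)
  show "\<Union> (star h (A \<union> B)) \<subseteq> insert h (A \<union> B)" by (auto simp: star_def)
  have AB: "card (A \<union> B) \<le> card A + card B" by (rule card_Un_le)
  then show "card (insert h (A \<union> B)) \<le> card A + card B + 1"
    using card_insert_le_m1[of "Suc (card (A \<union> B))" "A \<union> B" h] by simp
  show "card (star h (A \<union> B)) \<le> 4"
    unfolding star_def using card_image_le[of "A \<union> B" "\<lambda>x. {h, x}"] AB assms by simp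
  have "card {e \<in> star h (A \<union> B). e \<subseteq> V} \<le> card (star h A)"
    by (rule card_mono) (use assms in \<open>auto simp: star_def\<close>)
  also have "\<dots> \<le> card A" unfolding star_def by (rule card_image_le[OF assms(1)])
  finally show "card {e \<in> star h (A \<union> B). e \<subseteq> V} \<le> 2" using assms by linarith
qed (use assms in \<open>auto simp: star_def\<close>)

text \<open>Each block takes up to two leaves of \<open>S\<close>, which may lie in
  \<open>V\<close>, and up to two leaves of \<open>L\<close>, which do not. A star has excess 1, so
  the total excess is half of \<open>card S\<close>, rounded up; the leaves of \<open>L\<close>
  cause no further excess.\<close>

lemma covers_star:
  assumes "finite S" "finite L" "card L \<le> card S" "L \<inter> V = {}"
  shows "covers 4 2 V (star h (S \<union> L)) (card S + card L + (card S + 1) div 2)"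
  using assms
proof (induction "card S" arbitrary: S L rule: less_induct)
  case less
  show ?case
  proof (cases "card S \<le> 2")
    case True
    show ?thesis
    proof (cases "S = {}")
      case True
      with less show ?thesis by (simp add: covers_empty)
    next
      case False
      then have "card S > 0" using less by (simp add: card_gt_0_iff)
      then show ?thesis
        using covers_mono[OF covers_small_star[of S L V h] order_refl] True less by force
    qed
  next
    case False
    obtain A S' where S: "S = A \<union> S'" "card A \<le> 2" "card S' \<le> card S - 2" "card S = card A + card S'"
      "finite A" "finite S'"
      by (rule split_card[of S 2 "card S - 2"]) (use less.prems in auto)
    have A: "card A = 2" using S False by linarith
    obtain B L' where L: "L = B \<union> L'" "card B \<le> 2" "card L' \<le> card L - 2" "card L = card B + card L'"
      "finite B" "finite L'"
      by (rule split_card[of L 2 "card L - 2"]) (use less.prems in auto)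
    have "covers 4 2 V (star h (A \<union> B)) (card A + card B + 1)"
      by (rule covers_small_star) (use S L less in auto)
    moreover have "covers 4 2 V (star h (S' \<union> L')) (card S' + card L' + (card S' + 1) div 2)"
      by (rule less(1)) (use S L less A in auto)
    moreover have "star h (S \<union> L) = star h (A \<union> B) \<union> star h (S' \<union> L')"
      using S L by (auto simp: star_def)
    ultimately show ?thesis
      using covers_mono[OF covers_Un order_refl] S L A by fastforce
  qed
qed

text \<open>Two vertices of \<open>T\<close> at a time form a 4-cycle with \<open>p\<close> and
  \<open>q\<close>, and a 4-cycle has excess 0.\<close>

lemma covers_two_stars:
  assumes "finite T" "even (card T)" "T \<inter> V = {} \<or> p \<notin> V \<and> q \<notin> V"
  shows "covers 4 2 V (star p T \<union> star q T) (2 * card T)"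
  using assms
proof (induction "card T" arbitrary: T rule: less_induct)
  case less
  show ?case
  proof (cases "T = {}")
    case True
    then show ?thesis by (simp add: covers_empty)
  next
    case False
    then obtain x where x: "x \<in> T" by blast
    have "T - {x} \<noteq> {}" using less x by (metis card.empty card_Suc_Diff1 even_Suc even_zero)
    then obtain y where y: "y \<in> T" "y \<noteq> x" by blast
    define T' where "T' = T - {x, y}"
    have T: "T = insert x (insert y T')" using x y by (auto simp: T'_def)
    have c: "card T = 2 + card T'"
    proof -
      have "x \<notin> T'" "y \<notin> T'" "finite T'" using less.prems by (auto simp: T'_def)
      then show ?thesis using T y(2) by simp
    qed
    have "covers 4 2 V {{p, x}, {q, x}, {p, y}, {q, y}} 4"
      by (rule covers_edges[of _ _ _ _ _ "{p, q, x, y}"]) (use less x y in \<open>auto simp: card_le_four\<close>)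
    moreover have "covers 4 2 V (star p T' \<union> star q T') (2 * card T')"
      by (rule less(1)) (use less c T in auto)
    ultimately have "covers 4 2 V ({{p, x}, {q, x}, {p, y}, {q, y}} \<union> (star p T' \<union> star q T')) (4 + 2 * card T')"
      by (rule covers_Un)
    moreover have "star p T \<union> star q T = {{p, x}, {q, x}, {p, y}, {q, y}} \<union> (star p T' \<union> star q T')"
      unfolding T by auto
    ultimately show ?thesis unfolding c by (auto elim: covers_mono)
  qed
qed

lemma covers_spoked_triangle:
  assumes "p \<notin> V \<or> h \<notin> V" "finite A" "card A \<le> 1"
  shows "covers 4 2 V ({{h, p}, {h, q}, {p, q}} \<union> star h A) (3 + card A)"
proof (cases "A = {}")
  case True
  then show ?thesis
    using assms(1) covers_triangle[of p V h q] covers_triangle[of h V p q] by (auto simp: insert_commute)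
next
  case False
  then obtain x where "A = {x}"
    using assms by (metis card_1_singletonE card_0_eq le_neq_implies_less less_one)
  then show ?thesis
    using assms(1) covers_paw[of p V h h q x] covers_paw[of h V h p q x] by (auto simp: insert_commute)
qed

lemma obtain_two:
  assumes "finite T" "card T = n + 2"
  obtains p q T' where "T = insert p (insert q T')" "p \<noteq> q" "p \<notin> T'" "q \<notin> T'" "finite T'" "card T' = n"
proof -
  have "card T = Suc (Suc n)" using assms(2) by simp
  then show ?thesis using that by (metis card_Suc_eq_finite insert_iff)
qed

text \<open>The bound counts the edges, so no block has excess: \<open>T\<close> is split into
  pairs, each pair forms a triangle with \<open>h\<close> that carries at most one edge of
  \<open>star h S\<close>, and different pairs are joined by 4-cycles. That \<open>T\<close> has at
  most one vertex in \<open>V\<close> keeps enough edges of the 4-cycles outside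
  \<open>V\<close>.\<close>

lemma covers_hub:
  assumes "finite T" "card T = 2 * r" "finite S" "card S \<le> r"
    and "h \<notin> V \<or> T \<inter> V = {}" "\<And>x y. x \<in> T \<Longrightarrow> y \<in> T \<Longrightarrow> x \<noteq> y \<Longrightarrow> x \<notin> V \<or> y \<notin> V"
  shows "covers 4 2 V (complete_edges (insert h T) \<union> star h S) ((Suc (2 * r) choose 2) + card S)"
  using assms
proof (induction r arbitrary: T S)
  case 0
  then show ?case
    using complete_edges_insert[of h "{}"] covers_mono[OF covers_empty] by fastforce
next
  case (Suc r)
  obtain p q T' where T: "T = insert p (insert q T')" "p \<noteq> q" "p \<notin> T'" "q \<notin> T'" "finite T'" "card T' = 2 * r"
    by (rule obtain_two[of T "2 * r"]) (use Suc.prems in auto)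
  obtain A S' where S: "S = A \<union> S'" "card A \<le> 1" "card S' \<le> r" "card S = card A + card S'"
    "finite A" "finite S'"
    by (rule split_card[of S 1 r]) (use Suc.prems in auto)
  have "covers 4 2 V (complete_edges (insert h T') \<union> star h S') ((Suc (2 * r) choose 2) + card S')"
    by (rule Suc.IH) (use T S Suc.prems in auto)
  moreover have "covers 4 2 V (star p T' \<union> star q T') (2 * (2 * r))"
  proof -
    have "T' \<inter> V = {} \<or> p \<notin> V \<and> q \<notin> V" using T Suc.prems(6) by blast
    then show ?thesis using covers_two_stars[of T' V p q] T by simp
  qed
  moreover have "covers 4 2 V ({{h, p}, {h, q}, {p, q}} \<union> star h A) (3 + card A)"
    by (rule covers_spoked_triangle) (use T S Suc.prems in auto)
  ultimately have "covers 4 2 V ((complete_edges (insert h T') \<union> star h S') \<union> (star p T' \<union> star q T')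
      \<union> ({{h, p}, {h, q}, {p, q}} \<union> star h A))
      (((Suc (2 * r) choose 2) + card S') + 2 * (2 * r) + (3 + card A))"
    using covers_Un[OF covers_Un] by blast
  moreover have "complete_edges (insert h T) \<subseteq>
      {{h, p}, {h, q}, {p, q}} \<union> star p T' \<union> star q T' \<union> complete_edges (insert h T')"
  proof -
    have "insert h T = insert p (insert q (insert h T'))" using T by auto
    then show ?thesis
      using complete_edges_insert[of p "insert q (insert h T')"] complete_edges_insert[of q "insert h T'"]
      by (auto simp: insert_commute)
  qed
  ultimately show ?case
    using S by (elim covers_mono) (auto simp: star_Un choose_two_Suc)
qed

text \<open>The extra vertex \<open>u\<close> is joined to all vertices but \<open>h\<close>. The
  triangles \<open>h a c\<close> and \<open>h b d\<close> take the leaves of \<open>h\<close>, and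
  the edges \<open>a d\<close> and \<open>b c\<close> hang on the triangles \<open>u a b\<close> and
  \<open>u c d\<close>; all blocks have excess 0.\<close>

lemma covers_hub_extra_two_pairs:
  assumes "{a, b, c, d} \<inter> V = {}" "finite S" "card S \<le> 2"
  shows "covers 4 2 V (complete_edges {h, a, b, c, d} \<union> star u {a, b, c, d} \<union> star h S) (14 + card S)"
proof -
  obtain A B where S: "S = A \<union> B" "card A \<le> 1" "card B \<le> 1" "card S = card A + card B" "finite A" "finite B"
    by (rule split_card[of S 1 1]) (use assms in auto)
  have n: "a \<notin> V" "b \<notin> V" "c \<notin> V" "d \<notin> V" using assms by auto
  let ?R = "({{h, a}, {h, c}, {a, c}} \<union> star h A) \<union> ({{h, b}, {h, d}, {b, d}} \<union> star h B)
      \<union> {{a, u}, {a, b}, {u, b}, {a, d}} \<union> {{c, u}, {c, d}, {u, d}, {c, b}}"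
  have "covers 4 2 V ?R ((3 + card A) + (3 + card B) + 4 + 4)"
    using n S
    by (intro covers_Un[OF covers_Un[OF covers_Un[OF covers_spoked_triangle covers_spoked_triangle] covers_paw] covers_paw]) simp_all
  moreover have "complete_edges {h, a, b, c, d} \<union> star u {a, b, c, d} \<union> star h S \<subseteq> ?R"
    unfolding S(1) star_Un
    by (intro Un_least complete_edges_insert_subset) (simp_all add: insert_commute subset_insertI2 le_supI1)
  ultimately show ?thesis
    by (rule covers_mono) (simp add: S(4))
qed

text \<open>The triangles of \<open>h\<close> with the three pairs take the leaves of
  \<open>h\<close>, two more triangles join the first and the second members of the pairs, and each
  first member forms a triangle with \<open>u\<close> and the next second member, on which its edge
  to the remaining second member hangs.\<close>

lemma covers_hub_extra_three_pairs:
  assumes "{a1, b1, a2, b2, a3, b3} \<inter> V = {}" "finite S" "card S \<le> 3"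
  shows "covers 4 2 V (complete_edges {h, a1, b1, a2, b2, a3, b3} \<union> star u {a1, b1, a2, b2, a3, b3} \<union> star h S)
    (27 + card S)"
proof -
  obtain A S' where S: "S = A \<union> S'" "card A \<le> 1" "card S' \<le> 2" "card S = card A + card S'" "finite A" "finite S'"
    by (rule split_card[of S 1 2]) (use assms in auto)
  obtain B C where S': "S' = B \<union> C" "card B \<le> 1" "card C \<le> 1" "card S' = card B + card C" "finite B" "finite C"
    by (rule split_card[of S' 1 1]) (use S in auto)
  have n: "a1 \<notin> V" "a2 \<notin> V" "a3 \<notin> V" "b1 \<notin> V" "b2 \<notin> V" "b3 \<notin> V" using assms by auto
  let ?R1 = "({{h, a1}, {h, b1}, {a1, b1}} \<union> star h A) \<union> ({{h, a2}, {h, b2}, {a2, b2}} \<union> star h B)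
      \<union> ({{h, a3}, {h, b3}, {a3, b3}} \<union> star h C)"
  let ?R2 = "{{a1, a2}, {a1, a3}, {a2, a3}} \<union> {{b1, b2}, {b1, b3}, {b2, b3}}"
  let ?R3 = "{{a1, u}, {a1, b2}, {u, b2}, {a1, b3}} \<union> {{a2, u}, {a2, b3}, {u, b3}, {a2, b1}}
      \<union> {{a3, u}, {a3, b1}, {u, b1}, {a3, b2}}"
  have R1: "covers 4 2 V ?R1 ((3 + card A) + (3 + card B) + (3 + card C))"
    using n S S'
    by (intro covers_Un[OF covers_Un[OF covers_spoked_triangle covers_spoked_triangle] covers_spoked_triangle]) simp_all
  have R2: "covers 4 2 V ?R2 (3 + 3)"
    using n by (intro covers_Un[OF covers_triangle covers_triangle]) simp_all
  have R3: "covers 4 2 V ?R3 (4 + 4 + 4)"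
    using n by (intro covers_Un[OF covers_Un[OF covers_paw covers_paw] covers_paw]) simp_all
  have "complete_edges {h, a1, b1, a2, b2, a3, b3} \<union> star u {a1, b1, a2, b2, a3, b3} \<union> star h S \<subseteq> ?R1 \<union> ?R2 \<union> ?R3"
    unfolding S(1) S'(1) star_Un
    by (intro Un_least complete_edges_insert_subset) (simp_all add: insert_commute subset_insertI2 le_supI1)
  then show ?thesis
    by (rule covers_mono[OF covers_Un[OF covers_Un[OF R1 R2] R3]]) (simp add: S(4) S'(4))
qed

text \<open>Groups of four vertices are split off by \<open>covers_hub_extra_two_pairs\<close> and
  joined to the rest by 4-cycles. As this lowers \<open>r\<close> by 2 and must not go below 2,
  \<open>r = 3\<close> is a second base case. The excluded \<open>r = 1\<close> is the situation
  behind the exception for \<open>w = 3\<close>.\<close>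

lemma covers_hub_extra:
  assumes "finite T" "card T = 2 * r" "2 \<le> r" "T \<inter> V = {}" "finite S" "card S \<le> r"
  shows "covers 4 2 V (complete_edges (insert h T) \<union> star u T \<union> star h S)
    ((Suc (2 * r) choose 2) + 2 * r + card S)"
  using assms
proof (induction r arbitrary: T S rule: less_induct)
  case (less r)
  consider "r = 2" | "r = 3" | "r \<ge> 4" using less.prems by linarith
  then show ?case
  proof cases
    case 1
    obtain a b T1 where 1: "T = insert a (insert b T1)" "finite T1" "card T1 = 2"
      by (rule obtain_two[of T 2]) (use less.prems \<open>r = 2\<close> in auto)
    obtain c d T2 where 2: "T1 = insert c (insert d T2)" "finite T2" "card T2 = 0"
      by (rule obtain_two[of T1 0]) (use 1 in auto)
    have T: "T = {a, b, c, d}" using 1 2 by auto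
    show ?thesis
      using covers_hub_extra_two_pairs[of a b c d V S h u] less.prems \<open>r = 2\<close>
      unfolding T by (simp add: choose_two)
  next
    case 2
    obtain a1 b1 T1 where 1: "T = insert a1 (insert b1 T1)" "finite T1" "card T1 = 4"
      by (rule obtain_two[of T 4]) (use less.prems \<open>r = 3\<close> in auto)
    obtain a2 b2 T2 where 2: "T1 = insert a2 (insert b2 T2)" "finite T2" "card T2 = 2"
      by (rule obtain_two[of T1 2]) (use 1 in auto)
    obtain a3 b3 T3 where 3: "T2 = insert a3 (insert b3 T3)" "finite T3" "card T3 = 0"
      by (rule obtain_two[of T2 0]) (use 2 in auto)
    have T: "T = {a1, b1, a2, b2, a3, b3}" using 1 2 3 by auto
    show ?thesis
      using covers_hub_extra_three_pairs[of a1 b1 a2 b2 a3 b3 V S h u] less.prems \<open>r = 3\<close>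
      unfolding T by (simp add: choose_two)
  next
    case 3
    define s where "s = r - 2"
    then have s: "r = Suc (Suc s)" "2 \<le> s" using 3 by simp_all
    obtain a b T1 where 1: "T = insert a (insert b T1)" "a \<notin> T1" "b \<notin> T1" "a \<noteq> b" "finite T1" "card T1 = 2 * s + 2"
      by (rule obtain_two[of T "2 * s + 2"]) (use less.prems s in auto)
    obtain c d T' where 2: "T1 = insert c (insert d T')" "c \<notin> T'" "d \<notin> T'" "c \<noteq> d" "finite T'" "card T' = 2 * s"
      by (rule obtain_two[of T1 "2 * s"]) (use 1 in auto)
    obtain A S' where S: "S = A \<union> S'" "card A \<le> 2" "card S' \<le> s" "card S = card A + card S'" "finite A" "finite S'"
      by (rule split_card[of S 2 s]) (use less.prems s in auto)
    have "covers 4 2 V (complete_edges {h, a, b, c, d} \<union> star u {a, b, c, d} \<union> star h A) (14 + card A)"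
      by (rule covers_hub_extra_two_pairs) (use 1 2 S less.prems in auto)
    moreover have "covers 4 2 V (complete_edges (insert h T') \<union> star u T' \<union> star h S')
        ((Suc (2 * s) choose 2) + 2 * s + card S')"
      using 1 2 S s less.prems by (intro less.IH) auto
    moreover have "covers 4 2 V (star x T' \<union> star y T') (2 * (2 * s))" for x y
      using covers_two_stars[of T' V x y] 1 2 less.prems by auto
    ultimately have "covers 4 2 V ((complete_edges (insert h {a, b, c, d}) \<union> star u {a, b, c, d} \<union> star h A)
        \<union> (complete_edges (insert h T') \<union> star u T' \<union> star h S') \<union> (star a T' \<union> star b T') \<union> (star c T' \<union> star d T'))
        ((14 + card A) + ((Suc (2 * s) choose 2) + 2 * s + card S')
          + 2 * (2 * s) + 2 * (2 * s))"
      using covers_Un[OF covers_Un[OF covers_Un]] by blast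
    then show ?thesis
    proof (rule covers_mono)
      have *: "insert h T = insert h {a, b, c, d} \<union> T'" using 1 2 by auto
      \<comment> \<open>The intersection discards a possible singleton \<open>{h}\<close>, since
        \<open>h \<notin> T'\<close> is not assumed.\<close>
      have "(\<Union>x\<in>insert h {a, b, c, d}. star x T') \<inter> complete_edges (insert h T)
          \<subseteq> complete_edges (insert h T') \<union> (star a T' \<union> star b T') \<union> (star c T' \<union> star d T')"
        by (auto simp: star_def complete_edges_def)
      then have "complete_edges (insert h T) \<subseteq> complete_edges (insert h {a, b, c, d})
          \<union> complete_edges (insert h T') \<union> (star a T' \<union> star b T') \<union> (star c T' \<union> star d T')"
        using complete_edges_Un[of "insert h {a, b, c, d}" T', folded *] complete_edges_mono[of T' "insert h T'"]
        by blast
      moreover have "star u T = star u {a, b, c, d} \<union> star u T'" using 1 2 by (auto simp: star_def)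
      moreover have "star h S = star h A \<union> star h S'" by (simp add: S(1) star_Un)
      ultimately show "complete_edges (insert h T) \<union> star u T \<union> star h S \<subseteq>
        (complete_edges (insert h {a, b, c, d}) \<union> star u {a, b, c, d} \<union> star h A)
        \<union> (complete_edges (insert h T') \<union> star u T' \<union> star h S') \<union> (star a T' \<union> star b T') \<union> (star c T' \<union> star d T')"
        by (simp only: Un_subset_iff) blast
    qed (use S s in \<open>simp add: choose_two_Suc choose_two\<close>)
  qed
qed

section \<open>Zigzag paths\<close>

lemma covers_fan:
  assumes "w \<notin> V" "\<And>j. j < n \<Longrightarrow> u j = w \<or> u j = x j \<or> u j = y j"
  shows "covers 4 2 V (\<Union>j<n. {{w, x j}, {w, y j}, {x j, y j}, {u j, s j}}) (n * 4)"
  using assms by (intro covers_UN_lessThan covers_paw) auto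

lemma covers_triangle_fan:
  assumes "w \<notin> V" "finite B" "card B \<le> n"
  shows "covers 4 2 V ((\<Union>j<n. {{w, x j}, {w, y j}, {x j, y j}}) \<union> star w B) (n * 3 + card B)"
  using assms
proof (induction n arbitrary: B)
  case 0
  then show ?case by (simp add: covers_empty)
next
  case (Suc n)
  obtain A B' where B: "B = A \<union> B'" "card A \<le> 1" "card B' \<le> n" "card B = card A + card B'" "finite A" "finite B'"
    by (rule split_card[of B 1 n]) (use Suc.prems in auto)
  have "covers 4 2 V ((\<Union>j<n. {{w, x j}, {w, y j}, {x j, y j}}) \<union> star w B') (n * 3 + card B')"
    by (rule Suc.IH) (use B Suc.prems in auto)
  moreover have "covers 4 2 V ({{w, x n}, {w, y n}, {x n, y n}} \<union> star w A) (3 + card A)"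
    by (rule covers_spoked_triangle) (use B Suc.prems in auto)
  ultimately have "covers 4 2 V (((\<Union>j<n. {{w, x j}, {w, y j}, {x j, y j}}) \<union> star w B')
      \<union> ({{w, x n}, {w, y n}, {x n, y n}} \<union> star w A)) (n * 3 + card B' + (3 + card A))"
    by (rule covers_Un)
  then show ?case
    by (rule covers_mono) (auto simp: B(1) star_Un lessThan_Suc, simp add: B(1)[symmetric] B(4))
qed

text \<open>The path \<open>x 0, y 0, x 1, y 1, ...\<close> that ends in \<open>y (m - 1)\<close>.
  The first set is the matching of its first, third, fifth edge and so on, the second set holds the
  edges in between.\<close>

definition zigzag_path :: "nat \<Rightarrow> (nat \<Rightarrow> 'a) \<Rightarrow> (nat \<Rightarrow> 'a) \<Rightarrow> 'a set set" where
  "zigzag_path m x y = (\<lambda>j. {x j, y j}) ` {..<m} \<union> (\<lambda>j. {y j, x (Suc j)}) ` {..<m - 1}"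

lemma zigzag_path_subsetI:
  assumes "\<And>j. j < m \<Longrightarrow> {x j, y j} \<in> K" "\<And>j. Suc j < m \<Longrightarrow> {y j, x (Suc j)} \<in> K"
  shows "zigzag_path m x y \<subseteq> K"
  unfolding zigzag_path_def by (intro Un_least image_subsetI) (simp_all add: assms)

text \<open>On \<open>Y = \<int>\<^sub>2\<^sub>m\<close> the paths are \<open>i, i - 1, i + 1, i - 2, \<dots>\<close>: path \<open>i\<close> consists of
  the edges whose ends sum to \<open>2 i - 1\<close> or \<open>2 i\<close>.\<close>

definition zigzag_family :: "'a set \<Rightarrow> nat \<Rightarrow> (nat \<Rightarrow> nat \<Rightarrow> 'a) \<Rightarrow> (nat \<Rightarrow> nat \<Rightarrow> 'a) \<Rightarrow> bool" where
  "zigzag_family Y m a b \<longleftrightarrow>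
     (\<forall>i j. a i j = a j i) \<and>
     (\<forall>i. Y \<subseteq> a i ` {..<m} \<union> b i ` {..<m}) \<and>
     Y \<subseteq> (\<lambda>i. a i 0) ` {..<m} \<union> (\<lambda>i. b i (m - 1)) ` {..<m} \<and>
     complete_edges Y \<subseteq> (\<Union>i<m. zigzag_path m (a i) (b i))"

lemma zigzag_familyD:
  assumes "zigzag_family Y m a b"
  shows "a i j = a j i" and "Y \<subseteq> a i ` {..<m} \<union> b i ` {..<m}"
    and "Y \<subseteq> (\<lambda>i. a i 0) ` {..<m} \<union> (\<lambda>i. b i (m - 1)) ` {..<m}"
    and "complete_edges Y \<subseteq> (\<Union>i<m. zigzag_path m (a i) (b i))"
  using assms unfolding zigzag_family_def by blast+

text \<open>With indices modulo \<open>2 m\<close>, \<open>a i j\<close> is the vertex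
  \<open>i + j\<close> and \<open>b i j\<close> the vertex \<open>i - 1 - j\<close>. The edge
  \<open>{a i j, b i j}\<close> has index sum \<open>2 i - 1\<close> and
  \<open>{b i j, a i (j + 1)}\<close> has \<open>2 i\<close>, so the index sum of an arbitrary edge
  selects its path.\<close>

lemma ex_zigzag_family:
  assumes "finite Y" "card Y = 2 * m"
  shows "\<exists>a b. zigzag_family Y m a b"
proof (cases "m = 0")
  case True
  with assms have "Y = {}" by simp
  with True show ?thesis by (auto simp: zigzag_family_def intro!: exI[of _ "\<lambda>_ _. undefined"])
next
  case False
  define M where "M = 2 * int m"
  have M: "M > 0" using False by (simp add: M_def)
  obtain y where y: "bij_betw y {0..<2 * m} Y"
    using ex_bij_betw_nat_finite[OF assms(1)] assms(2) by auto
  define f where "f k = y (nat (k mod M))" for k :: int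
  have shift: "f (k + M * l) = f k" for k l by (simp add: f_def)
  define a where "a i j = f (int i + int j)" for i j
  define b where "b i j = f (int i - 1 - int j)" for i j
  have onto: "\<exists>p. 0 \<le> p \<and> p < M \<and> x = f p" if x: "x \<in> Y" for x
  proof -
    obtain k where "k < 2 * m" "x = y k" using y x by (auto simp: bij_betw_def)
    then show ?thesis by (intro exI[of _ "int k"]) (auto simp: f_def M_def)
  qed
  \<comment> \<open>For \<open>0 \<le> j < 2 m\<close> the vertex \<open>i + j\<close> occurs as
    entry \<open>j\<close> of \<open>a i\<close> and as entry \<open>2 m - 1 - j\<close> of
    \<open>b i\<close>; one of the two entries is below \<open>m\<close>.\<close>
  have reflect: "f k = b i (nat (M - 1 - j))" if "k = int i + j + M * l" "j < M" for k i j l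
  proof -
    have "int i - 1 - int (nat (M - 1 - j)) = k + M * (- l - 1)" using that by (simp add: algebra_simps)
    then show ?thesis unfolding b_def using shift by metis
  qed
  have direct: "f k = a i (nat j)" if "k = int i + j + M * l" "0 \<le> j" for k i j l
    using that shift[of "int i + j" l] by (simp add: a_def)
  have ex: "\<exists>j l. 0 \<le> j \<and> j < M \<and> k = i + j + M * l" for k i :: int
    by (rule exI[of _ "(k - i) mod M"], rule exI[of _ "(k - i) div M"]) (use M in auto)
  have "zigzag_family Y m a b"
    unfolding zigzag_family_def
  proof (intro conjI allI)
    show "a i j = a j i" for i j by (simp add: a_def add.commute)
    show "Y \<subseteq> a i ` {..<m} \<union> b i ` {..<m}" for i
    proof
      fix x assume "x \<in> Y"
      then obtain p where p: "x = f p" using onto by blast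
      obtain j l where j: "0 \<le> j" "j < M" "p = int i + j + M * l" using ex by blast
      show "x \<in> a i ` {..<m} \<union> b i ` {..<m}"
      proof (cases "j < int m")
        case True
        then show ?thesis using direct[OF j(3,1)] p j(1) by (auto intro!: image_eqI[of _ _ "nat j"])
      next
        case False
        then show ?thesis
          using reflect[OF j(3,2)] p j(2) by (auto simp: M_def intro!: image_eqI[of _ _ "nat (M - 1 - j)"])
      qed
    qed
    show "Y \<subseteq> (\<lambda>i. a i 0) ` {..<m} \<union> (\<lambda>i. b i (m - 1)) ` {..<m}"
    proof
      fix x assume "x \<in> Y"
      then obtain p where p: "0 \<le> p" "p < M" "x = f p" using onto by blast
      show "x \<in> (\<lambda>i. a i 0) ` {..<m} \<union> (\<lambda>i. b i (m - 1)) ` {..<m}"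
      proof (cases "p < int m")
        case True
        then have "x = a (nat p) 0" using p by (simp add: a_def)
        then show ?thesis using True p(1) by auto
      next
        case False
        \<comment> \<open>Path \<open>i\<close> ends at \<open>i - m\<close>, which is
          \<open>i + m\<close> modulo \<open>2 m\<close>; so the starts form the lower half and the
          ends the upper half.\<close>
        have "int (nat (p - int m)) - 1 - int (m - 1) = p + M * (- 1)"
          using False \<open>m \<noteq> 0\<close> by (simp add: M_def of_nat_diff)
        then have "x = b (nat (p - int m)) (m - 1)" unfolding b_def p(3) using shift by metis
        then show ?thesis using False p by (auto simp: M_def)
      qed
    qed
    show "complete_edges Y \<subseteq> (\<Union>i<m. zigzag_path m (a i) (b i))"
    proof
      fix e assume "e \<in> complete_edges Y"
      then have e: "card e = 2" "e \<subseteq> Y" by (simp_all add: complete_edges_def)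
      then obtain x x' where x: "e = {x, x'}" "x \<noteq> x'" using card_2_iff[of e] by blast
      obtain p q where pq: "x = f p" "x' = f q" "0 \<le> p" "p < M" "0 \<le> q" "q < M"
        using onto[of x] onto[of x'] e(2) x(1) by blast
      \<comment> \<open>Half of the index sum, rounded up. Its residue modulo \<open>m\<close> is
        the number of the path, because \<open>2 t\<close> matters only modulo
        \<open>2 m\<close>.\<close>
      define t where "t = (p + q + 1) div 2"
      have t: "p + q = 2 * t \<or> p + q = 2 * t - 1" unfolding t_def by presburger
      have tM: "0 \<le> t" "t < M" unfolding t_def using pq by linarith+
      obtain i r where i: "i < m" "t = int i + int m * r"
      proof (rule that)
        show "nat (t mod int m) < m" using False by (simp add: nat_less_iff)
        show "t = int (nat (t mod int m)) + int m * (t div int m)" using False by simp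
      qed
      obtain j l where j: "0 \<le> j" "j < M" "p = int i + j + M * l" using ex by blast
      have "{x, x'} \<in> zigzag_path m (a i) (b i)"
        using t
      proof
        assume s: "p + q = 2 * t - 1"
        have q: "q = int i + (M - 1 - j) + M * (r - l - 1)"
          using s i(2) j(3) by (simp add: M_def algebra_simps)
        have 1: "x = a i (nat j)" "x = b i (nat (M - 1 - j))"
          using direct[OF j(3,1)] reflect[OF j(3,2)] pq(1) by auto
        have 2: "x' = a i (nat (M - 1 - j))" "x' = b i (nat j)"
          using direct[OF q] reflect[OF q] pq(2) j by auto
        show ?thesis
        proof (cases "j < int m")
          case True
          then show ?thesis using 1(1) 2(2) j(1) unfolding zigzag_path_def by (auto intro!: image_eqI[of _ _ "nat j"])
        next
          case False
          then have "nat (M - 1 - j) < m" using j(2) by (simp add: M_def)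
          then show ?thesis using 1(2) 2(1) unfolding zigzag_path_def by (auto intro!: image_eqI[of _ _ "nat (M - 1 - j)"])
        qed
      next
        assume s: "p + q = 2 * t"
        have q: "q = int i + (M - j) + M * (r - l - 1)"
          using s i(2) j(3) by (simp add: M_def algebra_simps)
        \<comment> \<open>The values \<open>j = 0\<close> and \<open>j = m\<close> would make both
          ends of the edge equal modulo \<open>2 m\<close>.\<close>
        have "j \<noteq> 0"
        proof
          assume "j = 0"
          then have "q = p + M * (r - 2 * l)" using q j(3) by (simp add: algebra_simps)
          then show False using x(2) pq(1,2) shift by simp
        qed
        then have j0: "j \<ge> 1" using j(1) by simp
        have jm: "j \<noteq> int m"
        proof
          assume "j = int m"
          then have "q = p + M * (r - 2 * l - 1)" using q j(3) by (simp add: M_def algebra_simps)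
          then show False using x(2) pq(1,2) shift by simp
        qed
        have 1: "x = a i (nat j)" "x = b i (nat (M - 1 - j))"
          using direct[OF j(3,1)] reflect[OF j(3,2)] pq(1) by auto
        have 2: "x' = a i (nat (M - j))" "x' = b i (nat (j - 1))"
          using direct[OF q] reflect[OF q] pq(2) j j0 by auto
        show ?thesis
        proof (cases "j < int m")
          case True
          then have "nat j = Suc (nat (j - 1))" "nat (j - 1) < m - 1" using j0 by linarith+
          then show ?thesis using 1(1) 2(2) unfolding zigzag_path_def
            by (auto simp: insert_commute intro!: image_eqI[of _ _ "nat (j - 1)"])
        next
          case False
          then have "nat (M - j) = Suc (nat (M - 1 - j))" "nat (M - 1 - j) < m - 1"
            using j(2) jm by (simp_all add: M_def)
          then show ?thesis using 1(2) 2(1) unfolding zigzag_path_def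
            by (auto intro!: image_eqI[of _ _ "nat (M - 1 - j)"])
        qed
      qed
      then show "e \<in> (\<Union>i<m. zigzag_path m (a i) (b i))" using i(1) x(1) by blast
    qed
  qed
  then show ?thesis by blast
qed

lemma star_subset_ends:
  assumes "Y \<subseteq> x ` {..<m} \<union> y ` {..<m}" "\<And>j. j < m \<Longrightarrow> {w, x j} \<in> K" "\<And>j. j < m \<Longrightarrow> {w, y j} \<in> K"
  shows "star w Y \<subseteq> K"
proof (rule star_subsetI)
  fix z assume "z \<in> Y"
  then obtain j where "j < m" "z = x j \<or> z = y j" using assms(1) by fast
  then show "{w, z} \<in> K" using assms(2,3) by metis
qed

text \<open>The edge \<open>{y j, x (Suc j)}\<close> hangs on the triangle
  \<open>w, x j, y j\<close>; the last triangle has no such edge and can take one more edge at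
  \<open>w\<close>. The bound counts the edges.\<close>

lemma covers_zigzag_fan:
  assumes "w \<notin> V" "m \<ge> 1" "Y \<subseteq> x ` {..<m} \<union> y ` {..<m}" "finite A" "card A \<le> 1"
  shows "covers 4 2 V (zigzag_path m x y \<union> star w Y \<union> star w A) (4 * m - 1 + card A)"
proof -
  obtain k where k: "m = Suc k" using assms(2) by (cases m) auto
  let ?F = "\<lambda>j. {{w, x j}, {w, y j}, {x j, y j}, {y j, x (Suc j)}}"
  let ?G = "{{w, x k}, {w, y k}, {x k, y k}} \<union> star w A"
  let ?R = "(\<Union>j<k. ?F j) \<union> ?G"
  have "covers 4 2 V ?R (k * 4 + (3 + card A))"
    by (rule covers_Un[OF covers_fan covers_spoked_triangle]) (use assms in auto)
  then show ?thesis
  proof (rule covers_mono)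
    have F: "e \<in> ?F j \<Longrightarrow> j < k \<Longrightarrow> e \<in> ?R" for e j by (intro UnI1 UN_I[of j]) simp_all
    have G: "e \<in> ?G \<Longrightarrow> e \<in> ?R" for e by (rule UnI2)
    have "{w, x j} \<in> ?R" "{w, y j} \<in> ?R" "{x j, y j} \<in> ?R" if "j < m" for j
      using that F[of _ j] G k by (cases "j = k"; simp)+
    moreover have "{y j, x (Suc j)} \<in> ?R" if "Suc j < m" for j
      using that F[of _ j] k by simp
    moreover have "star w A \<subseteq> ?R" by (intro le_supI2 order_refl)
    ultimately show "zigzag_path m x y \<union> star w Y \<union> star w A \<subseteq> ?R"
      by (intro Un_least zigzag_path_subsetI star_subset_ends[OF assms(3)])
  qed (simp add: k)
qed

text \<open>Lets \<open>h\<close> follow \<open>y (m - 1)\<close>, so that the path prolonged to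
  \<open>h\<close> is given by one formula.\<close>

lemma zigzag_full:
  fixes x y :: "nat \<Rightarrow> 'a" and h :: 'a and m :: nat
  assumes "m \<ge> 1"
  obtains z where "\<And>j. Suc j < m \<Longrightarrow> z j = x (Suc j)" "z (m - 1) = h"
  using assms by (intro that[of "\<lambda>j. if Suc j < m then x (Suc j) else h"]) auto

text \<open>As in \<open>covers_zigzag_fan\<close>, but the last triangle takes the edge from the
  end of the path to \<open>h\<close>.\<close>

lemma covers_zigzag_full_fan:
  assumes "w \<notin> V" "m \<ge> 1" "Y \<subseteq> x ` {..<m} \<union> y ` {..<m}"
  shows "covers 4 2 V (zigzag_path m x y \<union> star w Y \<union> star h {y (m - 1)}) (m * 4)"
proof -
  obtain z where z: "\<And>j. Suc j < m \<Longrightarrow> z j = x (Suc j)" "z (m - 1) = h" using zigzag_full[OF assms(2)] by metis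
  let ?F = "\<lambda>j. {{w, x j}, {w, y j}, {x j, y j}, {y j, z j}}"
  let ?R = "\<Union>j<m. ?F j"
  have "covers 4 2 V ?R (m * 4)"
    using assms by (intro covers_fan) auto
  then show ?thesis
  proof (rule covers_mono)
    have F: "e \<in> ?F j \<Longrightarrow> j < m \<Longrightarrow> e \<in> ?R" for e j by (intro UN_I[of j]) simp_all
    have "{w, x j} \<in> ?R" "{w, y j} \<in> ?R" "{x j, y j} \<in> ?R" if "j < m" for j
      using that by (auto intro!: F[of _ j])
    moreover have "{y j, x (Suc j)} \<in> ?R" if "Suc j < m" for j
      by (rule F[of _ j]) (use that z in simp_all)
    moreover have "{h, y (m - 1)} \<in> ?R"
      by (rule F[of _ "m - 1"]) (use z assms(2) in \<open>simp_all add: insert_commute\<close>)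
    ultimately show "zigzag_path m x y \<union> star w Y \<union> star h {y (m - 1)} \<subseteq> ?R"
      by (intro Un_least zigzag_path_subsetI star_subset_ends[OF assms(3)]) simp_all
  qed simp
qed

text \<open>The path prolonged to \<open>h\<close> has \<open>2 * m\<close> edges and falls into
  \<open>m\<close> cherries centred at the \<open>y j\<close>, each of excess 1. No vertex of
  \<open>W\<close> is consumed.\<close>

lemma covers_zigzag_cherries:
  assumes "m \<ge> 1"
  shows "covers 4 2 V (zigzag_path m x y \<union> star h {y (m - 1)}) (m * 3)"
proof -
  obtain z where z: "\<And>j. Suc j < m \<Longrightarrow> z j = x (Suc j)" "z (m - 1) = h" using zigzag_full[OF assms] by metis
  let ?F = "\<lambda>j. {{x j, y j}, {y j, z j}}"
  let ?R = "\<Union>j<m. ?F j"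
  have "covers 4 2 V ?R (m * 3)"
    by (intro covers_UN_lessThan covers_cherry)
  then show ?thesis
  proof (rule covers_mono)
    have F: "e \<in> ?F j \<Longrightarrow> j < m \<Longrightarrow> e \<in> ?R" for e j by (intro UN_I[of j]) simp_all
    have "{x j, y j} \<in> ?R" if "j < m" for j
      using that by (auto intro!: F[of _ j])
    moreover have "{y j, x (Suc j)} \<in> ?R" if "Suc j < m" for j
      by (rule F[of _ j]) (use that z in simp_all)
    moreover have "{h, y (m - 1)} \<in> ?R"
      by (rule F[of _ "m - 1"]) (use z assms in \<open>simp_all add: insert_commute\<close>)
    ultimately show "zigzag_path m x y \<union> star h {y (m - 1)} \<subseteq> ?R"
      by (intro Un_least zigzag_path_subsetI) simp_all
  qed simp
qed

text \<open>\<open>w\<close> takes the matching edges of the path and \<open>w'\<close> the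
  \<open>m - 1\<close> others. The triangles of \<open>w'\<close> miss the two ends of the path, so
  the edges from \<open>w'\<close> to the ends hang on the first and the last triangle of
  \<open>w\<close>, which are distinct as \<open>m \<ge> 2\<close>.\<close>

lemma covers_double_fan:
  assumes "w \<notin> V" "w' \<notin> V" "m \<ge> 2" "Y \<subseteq> x ` {..<m} \<union> y ` {..<m}" "finite A" "card A \<le> 1"
  shows "covers 4 2 V (zigzag_path m x y \<union> star w Y \<union> star w' Y \<union> star w' A) (6 * m - 1 + card A)"
proof -
  define k where "k = m - 2"
  have k: "m = Suc (Suc k)" using assms(3) by (simp add: k_def)
  let ?P = "{{w, x 0}, {w, y 0}, {x 0, y 0}, {x 0, w'}}"
  let ?Q = "{{w, x (Suc k)}, {w, y (Suc k)}, {x (Suc k), y (Suc k)}, {y (Suc k), w'}}"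
  let ?F = "\<lambda>j. {{w, x (Suc j)}, {w, y (Suc j)}, {x (Suc j), y (Suc j)}}"
  let ?G = "\<lambda>j. {{w', y j}, {w', x (Suc j)}, {y j, x (Suc j)}}"
  let ?R = "?P \<union> ?Q \<union> ((\<Union>j<k. ?F j) \<union> star w {}) \<union> ((\<Union>j<Suc k. ?G j) \<union> star w' A)"
  have "covers 4 2 V ?R (4 + 4 + (k * 3 + card ({} :: 'a set)) + (Suc k * 3 + card A))"
    by (rule covers_Un[OF covers_Un[OF covers_Un[OF covers_paw covers_paw] covers_triangle_fan] covers_triangle_fan])
      (use assms in auto)
  then show ?thesis
  proof (rule covers_mono)
    have P: "e \<in> ?P \<Longrightarrow> e \<in> ?R" and Q: "e \<in> ?Q \<Longrightarrow> e \<in> ?R" for e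
      by (simp_all only: Un_iff simp_thms)
    have F: "e \<in> ?F j \<Longrightarrow> j < k \<Longrightarrow> e \<in> ?R" for e j by (intro UnI1 UnI2 UN_I[of j]) simp_all
    have G: "e \<in> ?G j \<Longrightarrow> j < Suc k \<Longrightarrow> e \<in> ?R" for e j by (intro UnI2 UnI1 UN_I[of j]) simp_all
    have E: "e \<in> ?R" if e: "e \<in> {{w, x j}, {w, y j}, {x j, y j}}" and "j < m" for e j
    proof -
      from \<open>j < m\<close> consider "j = 0" | "j = Suc k" | i where "j = Suc i" "i < k"
        using k by (metis less_Suc_eq not0_implies_Suc Suc_less_eq)
      then show ?thesis
      proof cases
        case 1 with e show ?thesis by (intro P) (simp only: insert_iff empty_iff simp_thms, elim disjE; simp only: simp_thms)
      next
        case 2 with e show ?thesis by (intro Q) (simp only: insert_iff empty_iff simp_thms, elim disjE; simp only: simp_thms)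
      next
        case (3 i) with e show ?thesis by (intro F[of _ i]) (simp_all only:)
      qed
    qed
    have *: "{w, x j} \<in> ?R" "{w, y j} \<in> ?R" "{x j, y j} \<in> ?R" if "j < m" for j
      by (rule E[OF _ that]; simp)+
    have **: "{y j, x (Suc j)} \<in> ?R" if "Suc j < m" for j
      by (rule G[of _ j]) (use that k in simp_all)
    have x: "{w', x j} \<in> ?R" if "j < m" for j
    proof (cases j)
      case 0 then show ?thesis by (intro P) (simp add: insert_commute)
    next
      case (Suc i) then show ?thesis by (intro G[of _ i]) (use that k in simp_all)
    qed
    have y: "{w', y j} \<in> ?R" if "j < m" for j
    proof (cases "j = Suc k")
      case True then show ?thesis by (intro Q) (simp add: insert_commute)
    next
      case False then show ?thesis by (intro G[of _ j]) (use that k in simp_all)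
    qed
    have "star w' A \<subseteq> ?R" by (intro le_supI2 order_refl)
    with * ** x y show "zigzag_path m x y \<union> star w Y \<union> star w' Y \<union> star w' A \<subseteq> ?R"
      by (intro Un_least zigzag_path_subsetI star_subset_ends[OF assms(4)])
  qed (simp add: k)
qed

text \<open>\<open>w\<close> and \<open>w'\<close> share a path, and the triangles of
  \<open>w\<close> now carry the edges from \<open>h\<close> to all \<open>x j\<close>. The two ends
  missed by \<open>w'\<close> are served by \<open>?H\<close>, a triangle on \<open>w'\<close>,
  \<open>h\<close> and \<open>y (m - 1)\<close>. The \<open>m - 1\<close> other triangles of
  \<open>w'\<close> stay free for \<open>B\<close>.\<close>

lemma covers_double_fan_hub:
  assumes "w \<notin> V" "w' \<notin> V" "m \<ge> 1" "Y \<subseteq> x ` {..<m} \<union> y ` {..<m}" "finite B" "card B \<le> m - 1"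
  shows "covers 4 2 V (zigzag_path m x y \<union> star w Y \<union> star w' Y \<union> star h (x ` {..<m})
      \<union> star h {y (m - 1), w'} \<union> star w' B) (7 * m + 1 + card B)"
proof -
  obtain k where k: "m = Suc k" using assms(3) by (cases m) auto
  let ?F = "\<lambda>j. {{w, x j}, {w, y j}, {x j, y j}, {x j, h}}"
  let ?G = "\<lambda>j. {{w', y j}, {w', x (Suc j)}, {y j, x (Suc j)}}"
  let ?H = "{{w', y k}, {w', h}, {y k, h}, {w', x 0}}"
  let ?R = "(\<Union>j<m. ?F j) \<union> ((\<Union>j<k. ?G j) \<union> star w' B) \<union> ?H"
  have "covers 4 2 V ?R (m * 4 + (k * 3 + card B) + 4)"
    by (rule covers_Un[OF covers_Un[OF covers_fan covers_triangle_fan] covers_paw]) (use assms k in auto)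
  then show ?thesis
  proof (rule covers_mono)
    have F: "e \<in> ?F j \<Longrightarrow> j < m \<Longrightarrow> e \<in> ?R" for e j by (intro UnI1 UN_I[of j]) simp_all
    have G: "e \<in> ?G j \<Longrightarrow> j < k \<Longrightarrow> e \<in> ?R" for e j by (intro UnI1 UnI2 UN_I[of j]) simp_all
    have H: "e \<in> ?H \<Longrightarrow> e \<in> ?R" for e by (rule UnI2)
    have *: "{w, x j} \<in> ?R" "{w, y j} \<in> ?R" "{x j, y j} \<in> ?R" "{h, x j} \<in> ?R" if "j < m" for j
      by (rule F[of _ j]; use that in \<open>simp add: insert_commute\<close>)+
    have **: "{y j, x (Suc j)} \<in> ?R" if "Suc j < m" for j
      by (rule G[of _ j]) (use that k in simp_all)
    have x: "{w', x j} \<in> ?R" if "j < m" for j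
    proof (cases j)
      case 0 then show ?thesis by (intro H) simp
    next
      case (Suc i) then show ?thesis by (intro G[of _ i]) (use that k in simp_all)
    qed
    have y: "{w', y j} \<in> ?R" if "j < m" for j
    proof (cases "j = k")
      case True then show ?thesis by (intro H) simp
    next
      case False then show ?thesis by (intro G[of _ j]) (use that k in simp_all)
    qed
    have "star h (x ` {..<m}) \<subseteq> ?R" by (intro star_subsetI) (elim imageE, simp only: *(4) lessThan_iff)
    moreover have "star w' B \<subseteq> ?R" by (intro le_supI1 le_supI2 order_refl)
    moreover have "star h {y (m - 1), w'} \<subseteq> ?R"
      by (intro star_subsetI H) (simp only: insert_iff empty_iff, elim disjE; simp add: k insert_commute)
    ultimately show "zigzag_path m x y \<union> star w Y \<union> star w' Y \<union> star h (x ` {..<m})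
        \<union> star h {y (m - 1), w'} \<union> star w' B \<subseteq> ?R"
      using * ** x y by (intro Un_least zigzag_path_subsetI star_subset_ends[OF assms(4)])
  qed (simp add: k)
qed

section \<open>Decompositions\<close>

lemma covers_complete_odd:
  assumes "finite T" "odd (card T)" "T \<inter> V = {}"
  shows "covers 4 2 V (complete_edges T) (card T choose 2)"
proof -
  obtain r where r: "card T = Suc (2 * r)" using assms(2) by (auto elim: oddE)
  then obtain h T' where T: "T = insert h T'" "h \<notin> T'" "finite T'" "card T' = 2 * r"
    using assms(1) by (metis card_Suc_eq_finite)
  have "covers 4 2 V (complete_edges (insert h T') \<union> star h {}) ((Suc (2 * r) choose 2) + card ({} :: 'a set))"
    by (rule covers_hub) (use T assms in auto)
  then show ?thesis using T(1) r by simp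
qed

text \<open>In general \<open>card W div 2\<close> leaves of \<open>S\<close> hang on triangles at
  \<open>h\<close>, and the others go in pairs into stars of excess 1. If \<open>card W\<close> is
  odd, a vertex \<open>u\<close> is set apart and \<open>{h, u}\<close> joins a star. Only
  \<open>card W = 3\<close> with odd \<open>card S\<close> costs one more.\<close>

lemma covers_center:
  assumes "finite W" "W \<inter> V = {}" "finite S" "card W \<le> card S"
  shows "covers 4 2 V (complete_edges (insert h W) \<union> star h S)
    ((Suc (card W) choose 2) + card S + (card S - card W div 2 + 1) div 2
      + (if card W = 3 \<and> odd (card S) then 1 else 0))"
proof -
  have split: "\<exists>S1 S2. S = S1 \<union> S2 \<and> card S1 = k \<and> card S2 = card S - k \<and> finite S1 \<and> finite S2"
    if "k \<le> card S" for k
  proof -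
    obtain S1 S2 where "S = S1 \<union> S2" "card S1 \<le> k" "card S2 \<le> card S - k" "card S = card S1 + card S2"
      "finite S1" "finite S2"
      by (rule split_card[of S k "card S - k"]) (use assms that in auto)
    then show ?thesis using that by (intro exI[of _ S1] exI[of _ S2]) linarith
  qed
  show ?thesis
  proof (cases "even (card W)")
    case True
    then obtain r where r: "card W = 2 * r" by (auto elim: evenE)
    obtain S1 S2 where S: "S = S1 \<union> S2" "card S1 = r" "card S2 = card S - r" "finite S1" "finite S2"
      using split[of r] r assms(4) by auto
    have "covers 4 2 V (complete_edges (insert h W) \<union> star h S1) ((Suc (2 * r) choose 2) + card S1)"
      by (rule covers_hub) (use assms r S in auto)
    moreover have "covers 4 2 V (star h (S2 \<union> {})) (card S2 + card ({} :: 'a set) + (card S2 + 1) div 2)"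
      by (rule covers_star) (use S in auto)
    ultimately have "covers 4 2 V ((complete_edges (insert h W) \<union> star h S1) \<union> star h (S2 \<union> {}))
        (((Suc (2 * r) choose 2) + card S1) + (card S2 + card ({} :: 'a set) + (card S2 + 1) div 2))"
      by (rule covers_Un)
    then show ?thesis
      by (rule covers_mono) (use S r assms(4) in \<open>simp_all add: star_Un le_supI1 le_supI2\<close>)
  next
    case False
    then obtain r where r: "card W = Suc (2 * r)" by (auto elim: oddE)
    then obtain u T where T: "W = insert u T" "u \<notin> T" "finite T" "card T = 2 * r"
      using assms(1) by (metis card_Suc_eq_finite)
    have sub: "complete_edges (insert h W) \<subseteq> star u T \<union> star h {u} \<union> complete_edges (insert h T)"
    proof -
      have "complete_edges (insert u (insert h T)) \<subseteq> star u (insert h T) \<union> complete_edges (insert h T)"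
        by (rule complete_edges_insert)
      then show ?thesis using T(1) star_Un[of u "{h}" T] star_singleton_flip[of u h] by (simp add: insert_commute)
    qed
    consider "r = 0" | "r = 1" "odd (card S)" | "r = 1" "even (card S)" | "r \<ge> 2" by linarith
    then show ?thesis
    proof cases
      case 1
      then have "T = {}" using T by simp
      have "covers 4 2 V (star h (S \<union> {u})) (card S + card {u} + (card S + 1) div 2)"
        by (rule covers_star) (use assms r T in auto)
      then show ?thesis
      proof (rule covers_mono)
        show "complete_edges (insert h W) \<union> star h S \<subseteq> star h (S \<union> {u})"
        proof -
          have "complete_edges (insert h W) \<subseteq> {{h, u}}"
            using sub complete_edges_insert[of h "{}"] unfolding \<open>T = {}\<close> by simp
          then show ?thesis unfolding star_Un by (intro Un_least) (erule order_trans, simp_all add: subset_insertI)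
        qed
      qed (use r 1 in \<open>simp add: choose_two\<close>)
    next
      case 2
      obtain S1 S2 where S: "S = S1 \<union> S2" "card S1 = 1" "card S2 = card S - 1" "finite S1" "finite S2"
        using split[of 1] r assms(4) by auto
      have "covers 4 2 V (complete_edges (insert h T) \<union> star h S1) ((Suc (2 * r) choose 2) + card S1)"
        by (rule covers_hub) (use assms r S T 2 in auto)
      \<comment> \<open>This star of excess 1 is the additional 1 in the bound.\<close>
      moreover have "covers 4 2 V (star u ({h} \<union> T)) (card {h} + card T + 1)"
        by (rule covers_small_star) (use T assms 2 in auto)
      moreover have "covers 4 2 V (star h (S2 \<union> {})) (card S2 + card ({} :: 'a set) + (card S2 + 1) div 2)"
        by (rule covers_star) (use S in auto)
      ultimately have "covers 4 2 V ((complete_edges (insert h T) \<union> star h S1) \<union> star u ({h} \<union> T) \<union> star h (S2 \<union> {}))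
        (((Suc (2 * r) choose 2) + card S1) + (card {h} + card T + 1)
          + (card S2 + card ({} :: 'a set) + (card S2 + 1) div 2))"
        using covers_Un[OF covers_Un] by blast
      then show ?thesis
      proof (rule covers_mono)
        show "complete_edges (insert h W) \<union> star h S
            \<subseteq> (complete_edges (insert h T) \<union> star h S1) \<union> star u ({h} \<union> T) \<union> star h (S2 \<union> {})"
          using sub unfolding S(1) star_Un star_singleton_flip[of h u] by auto
        have "card S \<ge> 3" using r assms(4) 2 by simp
        then show "((Suc (2 * r) choose 2) + card S1) + (card {h} + card T + 1)
            + (card S2 + card ({} :: 'a set) + (card S2 + 1) div 2)
          \<le> (Suc (card W) choose 2) + card S + (card S - card W div 2 + 1) div 2
            + (if card W = 3 \<and> odd (card S) then 1 else 0)"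
          using 2 r T S by (simp add: choose_two)
      qed
    next
      case 3
      obtain p q where T2: "T = {p, q}"
        using T(4) 3(1) card_2_iff[of T] by auto
      have "covers 4 2 V {{u, p}, {u, q}, {p, q}} 3"
        by (rule covers_triangle) (use T assms in auto)
      \<comment> \<open>For even \<open>card S\<close>, hanging one leaf on a triangle would save
        nothing after rounding, so all edges at \<open>h\<close> go into stars.\<close>
      moreover have "covers 4 2 V (star h (S \<union> W)) (card S + card W + (card S + 1) div 2)"
        by (rule covers_star) (use assms in auto)
      ultimately have "covers 4 2 V ({{u, p}, {u, q}, {p, q}} \<union> star h (S \<union> W)) (3 + (card S + card W + (card S + 1) div 2))"
        by (rule covers_Un)
      then show ?thesis
      proof (rule covers_mono)
        have "complete_edges (insert h W) \<subseteq> {{u, p}, {u, q}, {p, q}} \<union> star h (S \<union> W)"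
          unfolding T(1) T2
          by (intro complete_edges_insert_subset) (simp_all add: star_Un)
        then show "complete_edges (insert h W) \<union> star h S \<subseteq> {{u, p}, {u, q}, {p, q}} \<union> star h (S \<union> W)"
          by (simp add: star_Un subset_insertI2)
      qed (use 3 r in \<open>simp add: choose_two\<close>)
    next
      case 4
      obtain S1 S2 where S: "S = S1 \<union> S2" "card S1 = r" "card S2 = card S - r" "finite S1" "finite S2"
        using split[of r] r assms(4) by auto
      have "covers 4 2 V (complete_edges (insert h T) \<union> star u T \<union> star h S1)
          ((Suc (2 * r) choose 2) + 2 * r + card S1)"
        by (rule covers_hub_extra) (use assms r S T 4 in auto)
      moreover have "covers 4 2 V (star h (S2 \<union> {u})) (card S2 + card {u} + (card S2 + 1) div 2)"
        by (rule covers_star) (use S T assms r in auto)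
      ultimately have "covers 4 2 V ((complete_edges (insert h T) \<union> star u T \<union> star h S1) \<union> star h (S2 \<union> {u}))
        (((Suc (2 * r) choose 2) + 2 * r + card S1) + (card S2 + card {u} + (card S2 + 1) div 2))"
        by (rule covers_Un)
      then show ?thesis
      proof (rule covers_mono)
        show "complete_edges (insert h W) \<union> star h S
            \<subseteq> (complete_edges (insert h T) \<union> star u T \<union> star h S1) \<union> star h (S2 \<union> {u})"
          using sub unfolding S(1) star_Un by auto
      qed (use S r assms(4) in \<open>simp add: choose_two_Suc\<close>)
    qed
  qed
qed

lemma obtain_enum:
  assumes "finite W"
  obtains f :: "nat \<Rightarrow> 'a" where "inj_on f {..<card W}" "f ` {..<card W} = W"
proof -
  obtain g where "bij_betw g {0..<card W} W" using ex_bij_betw_nat_finite[OF assms] by blast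
  then show ?thesis by (intro that[of g]) (simp_all add: bij_betw_def atLeast0LessThan)
qed

text \<open>The first \<open>card W\<close> paths make fans at the vertices of \<open>W\<close>, the
  others are cut into cherries. Every path brings the edge from its end to \<open>h\<close>; the
  edges from \<open>h\<close> to the starts go with \<open>insert h W\<close> into
  \<open>covers_center\<close>.\<close>

lemma covers_large:
  assumes "finite Y" "card Y = 2 * m" "m \<ge> 1" "finite W" "card W \<le> m" "W \<inter> V = {}"
  shows "covers 4 2 V (complete_edges (insert h (Y \<union> W)))
    (card W * (m * 4) + (m - card W) * (m * 3) + ((Suc (card W) choose 2) + m + (m - card W div 2 + 1) div 2
      + (if card W = 3 \<and> odd m then 1 else 0)))"
proof -
  obtain a b where ab: "zigzag_family Y m a b" using ex_zigzag_family[OF assms(1,2)] by blast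
  note ab1 = zigzag_familyD(2)[OF ab] and ab2 = zigzag_familyD(3)[OF ab]
    and ab3 = zigzag_familyD(4)[OF ab]
  define S where "S = (\<lambda>i. a i 0) ` {..<m}"
  \<comment> \<open>Starts and ends together cover the \<open>2 * m\<close> vertices of
    \<open>Y\<close>, so the \<open>m\<close> starts are distinct.\<close>
  have cS: "card S = m"
  proof -
    have "card Y \<le> card (S \<union> (\<lambda>i. b i (m - 1)) ` {..<m})"
      by (rule card_mono) (use ab2 in \<open>auto simp: S_def\<close>)
    also have "\<dots> \<le> card S + card ((\<lambda>i. b i (m - 1)) ` {..<m})" by (rule card_Un_le)
    also have "card ((\<lambda>i. b i (m - 1)) ` {..<m}) \<le> m" using card_image_le[of "{..<m}"] by fastforce
    finally have "m \<le> card S" using assms(2) by linarith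
    moreover have "card S \<le> m" unfolding S_def using card_image_le[of "{..<m}"] by fastforce
    ultimately show ?thesis by simp
  qed
  obtain f where f: "inj_on f {..<card W}" "f ` {..<card W} = W" by (rule obtain_enum[OF assms(4)])
  let ?F = "\<lambda>i. zigzag_path m (a i) (b i) \<union> star (f i) Y \<union> star h {b i (m - 1)}"
  let ?G = "\<lambda>i. zigzag_path m (a i) (b i) \<union> star h {b i (m - 1)}"
  let ?H = "complete_edges (insert h W) \<union> star h S"
  define R where "R = (\<Union>i\<in>{..<card W}. ?F i) \<union> (\<Union>i\<in>{card W..<m}. ?G i) \<union> ?H"
  have "covers 4 2 V (\<Union>i\<in>{..<card W}. ?F i) (card {..<card W} * (m * 4))"
    by (intro covers_UN_const covers_zigzag_full_fan ab1) (use f assms in auto)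
  moreover have "covers 4 2 V (\<Union>i\<in>{card W..<m}. ?G i) (card {card W..<m} * (m * 3))"
    by (intro covers_UN_const covers_zigzag_cherries) (use assms in auto)
  moreover have "covers 4 2 V ?H ((Suc (card W) choose 2) + card S + (card S - card W div 2 + 1) div 2
      + (if card W = 3 \<and> odd (card S) then 1 else 0))"
    by (rule covers_center) (use assms cS in \<open>auto simp: S_def\<close>)
  ultimately have "covers 4 2 V R (card {..<card W} * (m * 4) + card {card W..<m} * (m * 3)
      + ((Suc (card W) choose 2) + card S + (card S - card W div 2 + 1) div 2
      + (if card W = 3 \<and> odd (card S) then 1 else 0)))"
    unfolding R_def using covers_Un[OF covers_Un] by blast
  then show ?thesis
  proof (rule covers_mono)
    have F: "?F i \<subseteq> R" if "i < card W" for i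
      unfolding R_def by (intro le_supI1 UN_upper) (use that in simp)
    have G: "?G i \<subseteq> R" if "i < m" for i
    proof (cases "i < card W")
      case True
      show ?thesis by (rule order_trans[OF _ F[OF True]]) (intro Un_mono Un_upper1 order_refl)
    next
      case False
      with that show ?thesis unfolding R_def by (intro le_supI1 le_supI2 UN_upper) simp
    qed
    have H: "?H \<subseteq> R" unfolding R_def by (rule Un_upper2)
    have "complete_edges Y \<subseteq> R"
    proof (intro order_trans[OF ab3] UN_least)
      fix i assume "i \<in> {..<m}"
      then show "zigzag_path m (a i) (b i) \<subseteq> R" using G[of i] by (simp only: Un_subset_iff lessThan_iff)
    qed
    moreover have "star x Y \<subseteq> R" if x: "x \<in> W" for x
    proof -
      obtain i where i: "i < card W" "x = f i" using x f(2) by blast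
      show ?thesis using F[OF i(1)] by (simp only: Un_subset_iff i(2))
    qed
    moreover have "star h Y \<subseteq> R"
    proof (rule order_trans)
      show "star h Y \<subseteq> star h S \<union> (\<Union>i<m. star h {b i (m - 1)})"
        using ab2 by (intro star_subsetI) (fastforce simp: S_def intro: in_star)
      show "star h S \<union> (\<Union>i<m. star h {b i (m - 1)}) \<subseteq> R"
        using H G by (intro Un_least UN_least) (simp_all only: Un_subset_iff lessThan_iff)
    qed
    moreover have "complete_edges (insert h W) \<subseteq> R" using H by (simp only: Un_subset_iff)
    ultimately have "complete_edges (insert h W \<union> Y) \<subseteq> R"
      by (intro complete_edges_Un_subset) auto
    moreover have "insert h W \<union> Y = insert h (Y \<union> W)" by auto
    ultimately show "complete_edges (insert h (Y \<union> W)) \<subseteq> R" by (simp only:)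
  qed (simp add: cS)
qed

text \<open>There is one path for each vertex of \<open>W\<close>, and no block has excess. For odd
  \<open>m\<close> the complete graph on \<open>W\<close> is treated alone; for even
  \<open>m\<close> the vertex \<open>f k\<close> is taken out, and its edges hang on the fans of the
  others, whose last triangles have room.\<close>

lemma covers_zero_mod_three:
  assumes "finite Y" "card Y = 2 * m" "finite W" "card W = m" "m \<ge> 1" "W \<inter> V = {}"
  shows "covers 4 2 V (complete_edges (W \<union> Y)) ((3 * m) choose 2)"
proof -
  obtain a b where ab: "zigzag_family Y m a b" using ex_zigzag_family[OF assms(1,2)] by blast
  obtain f where f: "inj_on f {..<m}" "f ` {..<m} = W" using obtain_enum[OF assms(3)] assms(4) by metis
  obtain k where k: "m = Suc k" using assms(5) by (cases m) auto
  let ?A = "if even m then {f k} else {}"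
  let ?W' = "if even m then f ` {..<k} else W"
  let ?F = "\<lambda>i. zigzag_path m (a i) (b i) \<union> star (f i) Y \<union> star (f i) ?A"
  let ?L = "zigzag_path m (a k) (b k) \<union> star (f k) Y \<union> star (f k) {}"
  have fV: "f i \<notin> V" if "i < m" for i using f(2) that assms(6) by blast
  have cW': "card ?W' = (if even m then k else m)"
    using assms(4) card_image[OF inj_on_subset[OF f(1), of "{..<k}"]] by (simp add: k)
  define R where "R = (\<Union>i\<in>{..<k}. ?F i) \<union> ?L \<union> complete_edges ?W'"
  have "covers 4 2 V (\<Union>i\<in>{..<k}. ?F i) (card {..<k} * (4 * m - 1 + card ?A))"
    by (intro covers_UN_const covers_zigzag_fan zigzag_familyD(2)[OF ab] fV) (use k in auto)
  moreover have "covers 4 2 V ?L (4 * m - 1 + card ({} :: 'a set))"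
    by (intro covers_zigzag_fan zigzag_familyD(2)[OF ab] fV) (use k in auto)
  moreover have "covers 4 2 V (complete_edges ?W') (card ?W' choose 2)"
  proof (rule covers_complete_odd)
    show "odd (card ?W')" unfolding cW' using k by simp
    show "?W' \<inter> V = {}" using fV assms(6) k by auto
  qed (use assms(3) in simp)
  ultimately have "covers 4 2 V R (card {..<k} * (4 * m - 1 + card ?A) + (4 * m - 1 + card ({} :: 'a set)) + (card ?W' choose 2))"
    unfolding R_def using covers_Un[OF covers_Un] by blast
  then show ?thesis
  proof (rule covers_mono)
    have F: "?F i \<subseteq> R" if "i < k" for i
      unfolding R_def by (intro le_supI1 UN_upper) (use that in simp)
    have L: "?L \<subseteq> R" unfolding R_def by (intro le_supI1 Un_upper2)
    have K: "complete_edges ?W' \<subseteq> R" unfolding R_def by (rule Un_upper2)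
    have G: "zigzag_path m (a i) (b i) \<subseteq> R \<and> star (f i) Y \<subseteq> R" if "i < m" for i
    proof (cases "i = k")
      case True
      then show ?thesis using L by (simp only: Un_subset_iff)
    next
      case False
      then have "i < k" using that k by simp
      then show ?thesis using F[of i] by (simp only: Un_subset_iff)
    qed
    have "complete_edges Y \<subseteq> R"
      by (intro order_trans[OF zigzag_familyD(4)[OF ab]] UN_least) (simp only: G lessThan_iff)
    moreover have "star x Y \<subseteq> R" if "x \<in> W" for x
      using that G unfolding f(2)[symmetric] by blast
    moreover have "complete_edges W \<subseteq> R"
    proof (cases "even m")
      case True
      have W: "W = insert (f k) (f ` {..<k})" using f(2) k by (auto simp: lessThan_Suc)
      have "star (f i) {f k} \<subseteq> R" if "i < k" for i
        using F[OF that] True by (simp only: Un_subset_iff if_True)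
      then have "star (f k) {f i} \<subseteq> R" if "i < k" for i
        using that star_singleton_flip[of "f k" "f i"] by metis
      then have "star (f k) (f ` {..<k}) \<subseteq> R" by (intro star_subsetI) auto
      then show ?thesis unfolding W using K True by (intro complete_edges_insert_subset) simp_all
    qed (use K in simp)
    ultimately show "complete_edges (W \<union> Y) \<subseteq> R" by (intro complete_edges_Un_subset)
    show "card {..<k} * (4 * m - 1 + card ?A) + (4 * m - 1 + card ({} :: 'a set)) + (card ?W' choose 2) \<le> 3 * m choose 2"
    proof -
      have "2 * ((3 * m) choose 2) = (3 * k + 3) * (3 * k + 2)" by (simp add: two_times_choose_two k)
      moreover have "2 * (k choose 2) + k = k * k" "2 * (Suc k choose 2) = k * k + k"
        by (cases k; simp add: two_times_choose_two algebra_simps)+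
      ultimately show ?thesis unfolding cW' by (cases "even m") (simp_all add: k algebra_simps)
    qed
  qed
qed

text \<open>\<open>W\<close> has one vertex more than there are paths, so path 0 serves both
  \<open>f 0\<close> and \<open>f m\<close>. If \<open>card W\<close> is even, \<open>f m\<close> is
  taken out of the complete graph on \<open>W\<close> and its edges hang on the fans.\<close>

lemma covers_one_mod_three:
  assumes "finite Y" "card Y = 2 * m" "finite W" "card W = Suc m" "m \<ge> 2" "W \<inter> V = {}"
  shows "covers 4 2 V (complete_edges (W \<union> Y)) ((3 * m + 1) choose 2)"
proof -
  obtain a b where ab: "zigzag_family Y m a b" using ex_zigzag_family[OF assms(1,2)] by blast
  obtain f where f: "inj_on f {..<Suc m}" "f ` {..<Suc m} = W" using obtain_enum[OF assms(3)] assms(4) by metis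
  \<comment> \<open>\<open>?A m\<close> is hung on the fans of the vertices with a path of their
    own; the edge between \<open>f 0\<close> and \<open>f m\<close> hangs on the fan of
    \<open>f m\<close>, hence \<open>?A 0\<close>.\<close>
  let ?A = "\<lambda>i. if odd m then {f i} else {}"
  let ?W' = "if odd m then f ` {..<m} else W"
  let ?F = "\<lambda>i. zigzag_path m (a i) (b i) \<union> star (f i) Y \<union> star (f i) (?A m)"
  let ?L = "zigzag_path m (a 0) (b 0) \<union> star (f 0) Y \<union> star (f m) Y \<union> star (f m) (?A 0)"
  have fV: "f i \<notin> V" if "i < Suc m" for i using f(2) that assms(6) by blast
  have cW': "card ?W' = (if odd m then m else Suc m)"
    using assms(4) card_image[OF inj_on_subset[OF f(1), of "{..<m}"]] by simp
  define R where "R = (\<Union>i\<in>{1..<m}. ?F i) \<union> ?L \<union> complete_edges ?W'"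
  have "covers 4 2 V (\<Union>i\<in>{1..<m}. ?F i) (card {1..<m} * (4 * m - 1 + card (?A m)))"
    by (intro covers_UN_const covers_zigzag_fan zigzag_familyD(2)[OF ab] fV) (use assms(5) in auto)
  moreover have "covers 4 2 V ?L (6 * m - 1 + card (?A 0))"
    by (intro covers_double_fan zigzag_familyD(2)[OF ab] fV) (use assms(5) in auto)
  moreover have "covers 4 2 V (complete_edges ?W') (card ?W' choose 2)"
  proof (rule covers_complete_odd)
    show "odd (card ?W')" unfolding cW' by simp
    show "?W' \<inter> V = {}" using fV assms(6) by auto
  qed (use assms(3) in simp)
  ultimately have "covers 4 2 V R (card {1..<m} * (4 * m - 1 + card (?A m)) + (6 * m - 1 + card (?A 0)) + (card ?W' choose 2))"
    unfolding R_def using covers_Un[OF covers_Un] by blast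
  then show ?thesis
  proof (rule covers_mono)
    have F: "?F i \<subseteq> R" if "1 \<le> i" "i < m" for i
      unfolding R_def by (intro le_supI1 UN_upper) (use that in simp)
    have L: "?L \<subseteq> R" unfolding R_def by (intro le_supI1 Un_upper2)
    have K: "complete_edges ?W' \<subseteq> R" unfolding R_def by (rule Un_upper2)
    have G: "zigzag_path m (a i) (b i) \<subseteq> R \<and> star (f i) Y \<subseteq> R" if "i < m" for i
    proof (cases "i = 0")
      case True
      then show ?thesis using L by (simp only: Un_subset_iff)
    next
      case False
      then have "1 \<le> i" by simp
      then show ?thesis using F[of i] that by (simp only: Un_subset_iff)
    qed
    have "complete_edges Y \<subseteq> R"
      by (intro order_trans[OF zigzag_familyD(4)[OF ab]] UN_least) (simp only: G lessThan_iff)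
    moreover have "star x Y \<subseteq> R" if x: "x \<in> W" for x
    proof -
      obtain i where i: "i < Suc m" "x = f i" using x f(2) by blast
      show ?thesis
      proof (cases "i = m")
        case True
        then show ?thesis using L i(2) by (simp only: Un_subset_iff)
      next
        case False
        then show ?thesis using G[of i] i by simp
      qed
    qed
    moreover have "complete_edges W \<subseteq> R"
    proof (cases "odd m")
      case True
      have W: "W = insert (f m) (f ` {..<m})" using f(2) by (auto simp: lessThan_Suc)
      have "star (f m) {f i} \<subseteq> R" if "i < m" for i
      proof (cases "i = 0")
        case 0: True
        then show ?thesis using L True by (simp only: Un_subset_iff if_True not_False_eq_True)
      next
        case False
        then have "1 \<le> i" by simp
        then show ?thesis using F[of i] that True star_singleton_flip[of "f m" "f i"]
          by (simp only: Un_subset_iff if_True not_False_eq_True simp_thms)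
      qed
      then have "star (f m) (f ` {..<m}) \<subseteq> R" by (intro star_subsetI) auto
      then show ?thesis unfolding W using K True by (intro complete_edges_insert_subset) simp_all
    qed (use K in simp)
    ultimately show "complete_edges (W \<union> Y) \<subseteq> R" by (intro complete_edges_Un_subset)
    show "card {1..<m} * (4 * m - 1 + card (?A m)) + (6 * m - 1 + card (?A 0)) + (card ?W' choose 2) \<le> 3 * m + 1 choose 2"
    proof -
      obtain k where k: "m = Suc k" using assms(5) by (cases m) auto
      have "2 * ((3 * m + 1) choose 2) = (3 * k + 4) * (3 * k + 3)"
        using two_times_choose_two[of "3 * m + 1"] by (simp add: k algebra_simps)
      moreover have "2 * (Suc k choose 2) = k * k + k" "2 * (Suc (Suc k) choose 2) = k * k + 3 * k + 2"
        by (simp_all add: two_times_choose_two algebra_simps)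
      ultimately show ?thesis unfolding cW' by (cases "odd m") (simp_all add: k algebra_simps)
    qed
  qed
qed

text \<open>Two triangles at \<open>p\<close> and the 4-cycle \<open>q x h y\<close>. This is the
  case of five vertices, in which the general construction has \<open>m = 1\<close> and no triangle
  at \<open>f 0\<close> to take its leaf.\<close>

lemma covers_five:
  assumes "p \<notin> V" "q \<notin> V"
  shows "covers 4 2 V (complete_edges {h, p, q, x, y}) 10"
proof -
  let ?R = "{{p, x}, {p, y}, {x, y}} \<union> {{p, q}, {p, h}, {q, h}} \<union> {{q, x}, {q, y}, {h, x}, {h, y}}"
  have "covers 4 2 V {{q, x}, {q, y}, {h, x}, {h, y}} 4"
    by (rule covers_edges[of _ _ _ _ _ "{q, x, y, h}"]) (use assms in \<open>simp_all add: card_le_four\<close>)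
  then have "covers 4 2 V ?R (3 + 3 + 4)"
    by (intro covers_Un[OF covers_Un[OF covers_triangle covers_triangle]] assms)
  moreover have "complete_edges {h, p, q, x, y} \<subseteq> ?R"
    by (intro complete_edges_insert_subset) (simp_all add: insert_commute)
  ultimately show ?thesis by (auto elim: covers_mono)
qed

text \<open>Path 0 is shared by \<open>f 0\<close> and \<open>f m\<close>, and a further vertex
  \<open>h\<close> must reach all of \<open>Y\<close>. The edges to the ends of the paths are taken
  along by the fans. By symmetry of \<open>a\<close>, the starts \<open>a i 0\<close> are the
  vertices \<open>a 0 i\<close> of path 0, which \<open>covers_double_fan_hub\<close> joins to
  \<open>h\<close>.\<close>

lemma covers_two_mod_three:
  assumes "finite Y" "card Y = 2 * m" "finite W" "card W = Suc m" "m \<ge> 2" "W \<inter> V = {}" "h \<notin> W"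
  shows "covers 4 2 V (complete_edges (insert h W \<union> Y)) ((3 * m + 2) choose 2)"
proof -
  obtain a b where ab: "zigzag_family Y m a b" using ex_zigzag_family[OF assms(1,2)] by blast
  obtain f where f: "inj_on f {..<Suc m}" "f ` {..<Suc m} = W" using obtain_enum[OF assms(3)] assms(4) by metis
  obtain k where k: "m = Suc k" "k \<ge> 1" using assms(5) by (cases m) auto
  define U where "U = f ` {1..<m}"
  have W: "W = insert (f m) (insert (f 0) U)"
  proof -
    have "{..<Suc m} = insert m (insert 0 {1..<m})" using assms(5) by auto
    then show ?thesis unfolding U_def f(2)[symmetric] by simp
  qed
  have cU: "card U = k"
    unfolding U_def using card_image[OF inj_on_subset[OF f(1), of "{1..<m}"]] k by force
  have U: "finite U" "U \<inter> V = {}" "h \<notin> U" "f 0 \<notin> V" "f m \<notin> V"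
    using assms(6,7) W by (auto simp: U_def)
  \<comment> \<open>What is left is \<open>insert h W\<close> without the edge
    \<open>{h, f m}\<close>, and the hub at \<open>f 0\<close> needs a \<open>T\<close> of even
    size. For even \<open>m\<close>, \<open>h\<close> joins \<open>U\<close> in \<open>T\<close> and
    \<open>f m\<close> reaches \<open>U\<close> by pendant edges; for odd \<open>m\<close>, 4-cycles
    join both \<open>f m\<close> and \<open>h\<close> to \<open>U\<close>.\<close>
  define B where "B = (if even m then U else {f 0})"
  define T where "T = (if even m then insert h U else U)"
  define S where "S = (if even m then {f m} else {h})"
  define D where "D = (if even m then {} else U)"
  have T: "finite T" "card T = (if even m then m else k)" using U cU k by (simp_all add: T_def)
  let ?F = "\<lambda>i. zigzag_path m (a i) (b i) \<union> star (f i) Y \<union> star h {b i (m - 1)}"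
  let ?L = "zigzag_path m (a 0) (b 0) \<union> star (f 0) Y \<union> star (f m) Y \<union> star h (a 0 ` {..<m})
      \<union> star h {b 0 (m - 1), f m} \<union> star (f m) B"
  let ?K = "complete_edges (insert (f 0) T) \<union> star (f 0) S"
  let ?D = "star (f m) D \<union> star h D"
  define R where "R = (\<Union>i\<in>{1..<m}. ?F i) \<union> ?L \<union> ?K \<union> ?D"
  have fV: "f i \<notin> V" if "i < Suc m" for i using f(2) that assms(6) by blast
  have "covers 4 2 V (\<Union>i\<in>{1..<m}. ?F i) (card {1..<m} * (m * 4))"
    by (intro covers_UN_const covers_zigzag_full_fan zigzag_familyD(2)[OF ab] fV) (use assms(5) in auto)
  moreover have "covers 4 2 V ?L (7 * m + 1 + card B)"
    by (intro covers_double_fan_hub zigzag_familyD(2)[OF ab] U) (use U cU k in \<open>auto simp: B_def\<close>)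
  moreover have "covers 4 2 V ?K ((Suc (2 * (card T div 2)) choose 2) + card S)"
  proof (rule covers_hub)
    show "card T = 2 * (card T div 2)" unfolding T using k by simp
    show "card S \<le> card T div 2" unfolding T S_def using k assms(5) by (cases "even m") auto
    show "x \<notin> V \<or> y \<notin> V" if "x \<in> T" "y \<in> T" "x \<noteq> y" for x y
      using that U by (auto simp: T_def split: if_splits)
  qed (use T U in \<open>auto simp: S_def\<close>)
  moreover have "covers 4 2 V ?D (2 * card D)"
    by (rule covers_two_stars) (use U cU k in \<open>auto simp: D_def\<close>)
  ultimately have "covers 4 2 V R (card {1..<m} * (m * 4) + (7 * m + 1 + card B)
      + ((Suc (2 * (card T div 2)) choose 2) + card S) + 2 * card D)"
    unfolding R_def using covers_Un[OF covers_Un[OF covers_Un]] by blast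
  then show ?thesis
  proof (rule covers_mono)
    have F: "?F i \<subseteq> R" if "1 \<le> i" "i < m" for i
      unfolding R_def by (intro le_supI1 UN_upper) (use that in simp)
    have L: "?L \<subseteq> R" unfolding R_def by (intro le_supI1 Un_upper2)
    have K: "?K \<subseteq> R" unfolding R_def by (intro le_supI1 Un_upper2)
    have D: "?D \<subseteq> R" unfolding R_def by (rule Un_upper2)
    have G: "zigzag_path m (a i) (b i) \<subseteq> R \<and> star (f i) Y \<subseteq> R" if "i < m" for i
    proof (cases "i = 0")
      case True
      then show ?thesis using L by (simp only: Un_subset_iff)
    next
      case False
      then have "1 \<le> i" by simp
      then show ?thesis using F[of i] that by (simp only: Un_subset_iff)
    qed
    have H: "star h {b i (m - 1)} \<subseteq> R" if "i < m" for i
    proof (cases "i = 0")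
      case True
      have "star h {b 0 (m - 1)} \<subseteq> star h {b 0 (m - 1), f m}" by auto
      then show ?thesis using L unfolding True by (simp only: Un_subset_iff) (meson order_trans)
    next
      case False
      then have "1 \<le> i" by simp
      then show ?thesis using F[of i] that by (simp only: Un_subset_iff)
    qed
    have "complete_edges Y \<subseteq> R"
      by (intro order_trans[OF zigzag_familyD(4)[OF ab]] UN_least) (simp only: G lessThan_iff)
    moreover have "star x Y \<subseteq> R" if x: "x \<in> W" for x
    proof -
      obtain i where i: "i < Suc m" "x = f i" using x f(2) by blast
      show ?thesis
      proof (cases "i = m")
        case True
        then show ?thesis using L i(2) by (simp only: Un_subset_iff)
      next
        case False
        then show ?thesis using G[of i] i by simp
      qed
    qed
    moreover have "star h Y \<subseteq> R"
    proof (rule order_trans)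
      have "(\<lambda>i. a i 0) ` {..<m} = a 0 ` {..<m}"
        using zigzag_familyD(1)[OF ab, of _ 0] by (intro image_cong) auto
      then show "star h Y \<subseteq> star h (a 0 ` {..<m}) \<union> (\<Union>i<m. star h {b i (m - 1)})"
        using zigzag_familyD(3)[OF ab] by (intro star_subsetI) (fastforce intro: in_star)
      have "star h (a 0 ` {..<m}) \<subseteq> R" using L by (simp only: Un_subset_iff)
      then show "star h (a 0 ` {..<m}) \<union> (\<Union>i<m. star h {b i (m - 1)}) \<subseteq> R"
        using H by (intro Un_least UN_least) (simp_all only: lessThan_iff)
    qed
    moreover have "complete_edges (insert h W) \<subseteq> R"
    proof -
      have hm: "{h, f m} \<in> R" and mB: "star (f m) B \<subseteq> R" using L by simp_all
      have 0: "complete_edges (insert (f 0) T) \<subseteq> R" "star (f 0) S \<subseteq> R" using K by simp_all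
      have d: "star (f m) D \<subseteq> R" "star h D \<subseteq> R" using D by simp_all
      show ?thesis
      proof (cases "even m")
        case True
        have "insert h W = insert (f m) (insert (f 0) T)" using True by (auto simp: W T_def)
        moreover have "star (f m) (insert (f 0) T) \<subseteq> R"
          using True hm mB 0(2) by (simp add: T_def B_def S_def insert_commute)
        ultimately show ?thesis using 0(1) by (simp only: complete_edges_insert_subset)
      next
        case False
        have "insert h W = insert (f m) (insert h (insert (f 0) T))" using False by (auto simp: W T_def)
        moreover have "star h (insert (f 0) T) \<subseteq> R" "star (f m) (insert h (insert (f 0) T)) \<subseteq> R"
          using False hm mB d 0(2) by (simp_all add: T_def B_def S_def D_def insert_commute)
        ultimately show ?thesis using 0(1) by (simp only: complete_edges_insert_subset)
      qed
    qed
    ultimately show "complete_edges (insert h W \<union> Y) \<subseteq> R"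
      by (intro complete_edges_Un_subset) auto
    show "card {1..<m} * (m * 4) + (7 * m + 1 + card B) + ((Suc (2 * (card T div 2)) choose 2) + card S) + 2 * card D
      \<le> 3 * m + 2 choose 2"
    proof -
      have "2 * ((3 * m + 2) choose 2) = (3 * k + 5) * (3 * k + 4)"
        using two_times_choose_two[of "3 * m + 2"] by (simp add: k algebra_simps)
      moreover have "2 * (Suc k choose 2) = k * k + k" "2 * (Suc (Suc k) choose 2) = k * k + 3 * k + 2"
        by (simp_all add: two_times_choose_two algebra_simps)
      moreover have "even m \<Longrightarrow> Suc (2 * (card T div 2)) = Suc (Suc k)" "odd m \<Longrightarrow> Suc (2 * (card T div 2)) = Suc k"
        unfolding T using k by simp_all
      ultimately show ?thesis
        using k cU by (cases "even m") (simp_all add: B_def S_def D_def algebra_simps)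
    qed
  qed
qed

text \<open>\<open>V\<close> is enlarged to size \<open>2 * p\<close> or \<open>2 * p + 1\<close>,
  for which decompositions without excess are available. The inequality in the hypothesis is
  \<open>v \<le> 2 * w - 1\<close> rewritten with \<open>card X = v + w\<close>.\<close>

lemma cost_ON2_small:
  fixes X V :: "'a set"
  assumes X: "finite X" "V \<subseteq> X" and n: "card X \<ge> 5" and v: "3 * card V < 2 * card X" "odd (card V)"
  shows "cost_ON2 X V 4 2 \<le> card X choose 2"
proof -
  define p where "p = card X div 3"
  have p: "card X = 3 * p \<or> card X = 3 * p + 1 \<or> card X = 3 * p + 2"
    unfolding p_def by presburger
  have enlarge: "\<exists>V'. V \<subseteq> V' \<and> V' \<subseteq> X \<and> card V' = k" if "card V \<le> k" "k \<le> card X" for k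
    using exists_subset_between[of V k X] that X by blast
  have "\<exists>V'. V \<subseteq> V' \<and> covers 4 2 V' (complete_edges X) (card X choose 2)"
    using p
  proof (elim disjE)
    assume c: "card X = 3 * p"
    then obtain Y where Y: "V \<subseteq> Y" "Y \<subseteq> X" "card Y = 2 * p" using enlarge[of "2 * p"] v by auto
    have "covers 4 2 Y (complete_edges ((X - Y) \<union> Y)) ((3 * p) choose 2)"
      by (rule covers_zero_mod_three) (use X Y c n finite_subset[OF Y(2)] in \<open>auto simp: card_Diff_subset\<close>)
    moreover have "(X - Y) \<union> Y = X" using Y by auto
    ultimately show ?thesis using Y(1) c by metis
  next
    assume c: "card X = 3 * p + 1"
    have "card V \<le> 2 * p" using c v by linarith
    then obtain Y where Y: "V \<subseteq> Y" "Y \<subseteq> X" "card Y = 2 * p" using enlarge[of "2 * p"] c by auto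
    have "covers 4 2 Y (complete_edges ((X - Y) \<union> Y)) ((3 * p + 1) choose 2)"
      by (rule covers_one_mod_three) (use X Y c n finite_subset[OF Y(2)] in \<open>auto simp: card_Diff_subset\<close>)
    moreover have "(X - Y) \<union> Y = X" using Y by auto
    ultimately show ?thesis using Y(1) c by metis
  next
    assume c: "card X = 3 * p + 2"
    have "card V \<le> 2 * p + 1" using c v by linarith
    then obtain V' where V': "V \<subseteq> V'" "V' \<subseteq> X" "card V' = 2 * p + 1" using enlarge[of "2 * p + 1"] c by auto
    obtain h where h: "h \<in> V'" using V'(3) by fastforce
    define Y where "Y = V' - {h}"
    define W where "W = X - V'"
    have fV': "finite V'" using X(1) V'(2) finite_subset by blast
    have Y: "finite Y" "card Y = 2 * p" using fV' h V'(3) by (simp_all add: Y_def)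
    have W: "finite W" "card W = Suc p" "W \<inter> V' = {}" "h \<notin> W"
      using X V' h c fV' by (auto simp: W_def card_Diff_subset)
    have XU: "insert h W \<union> Y = X" using h V'(2) by (auto simp: W_def Y_def)
    have "covers 4 2 V' (complete_edges (insert h W \<union> Y)) ((3 * p + 2) choose 2)"
    proof (cases "p \<ge> 2")
      case True
      then show ?thesis by (intro covers_two_mod_three Y W)
    next
      case False
      then have "p = 1" using c n by linarith
      then obtain x y p' q where xy: "Y = {x, y}" "W = {p', q}"
        using Y(2) W(2) card_2_iff[of Y] card_2_iff[of W] by (metis Suc_1 mult.right_neutral)
      have "insert h W \<union> Y = {h, p', q, x, y}" unfolding xy by auto
      moreover have "p' \<notin> V'" "q \<notin> V'" using W(3) xy by auto
      ultimately show ?thesis using covers_five[of p' V' q h x y] \<open>p = 1\<close> by (simp add: choose_two)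
    qed
    then show ?thesis using V'(1) XU c by metis
  qed
  then show ?thesis using cost_ON2_le_of_covers[OF X(1)] covers_superset by metis
qed

section \<open>Rounding and the formula for large \<open>V\<close>\<close>

lemma ceiling_half: "\<lceil>real_of_int n / 2\<rceil> = (n + 1) div 2"
  by (rule ceiling_unique) linarith+

lemma ceiling_nat_half: "\<lceil>real n / 2\<rceil> = (int n + 1) div 2"
  using ceiling_half[of "int n"] by simp

text \<open>Both bounds are proved with integer division; this connects them to the nested
  ceilings.\<close>

lemma ceiling_excess:
  "\<lceil>(real a - real v * real w + real_of_int \<lceil>real w / 2\<rceil>) / 2\<rceil>
    = (int a - int v * int w + (int w + 1) div 2 + 1) div 2"
  using ceiling_half[of "int a - int v * int w + (int w + 1) div 2"]
  by (simp add: ceiling_nat_half)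

lemma cost_ON2_large_le:
  fixes X V :: "'a set"
  assumes X: "finite X" "V \<subseteq> X" "card X = card V + w" and v: "card V = 2 * m + 1" "w \<le> m" "m \<ge> 1"
  shows "int (cost_ON2 X V 4 2) \<le> int (card X choose 2)
    + (int (card V choose 2) - int (card V) * int w + (int w + 1) div 2 + 1) div 2
    + (if w = 3 \<and> odd m then 1 else 0)"
proof -
  have fV: "finite V" using X finite_subset by blast
  obtain h where h: "h \<in> V" using v(1) by fastforce
  define Y where "Y = V - {h}"
  define W where "W = X - V"
  have Y: "finite Y" "card Y = 2 * m" using fV h v(1) by (simp_all add: Y_def)
  have W: "finite W" "card W = w" "W \<inter> V = {}"
    using X fV by (auto simp: W_def card_Diff_subset)
  have XU: "insert h (Y \<union> W) = X" using h X(2) by (auto simp: W_def Y_def)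
  let ?c = "w * (m * 4) + (m - w) * (m * 3) + ((Suc w choose 2) + m + (m - w div 2 + 1) div 2
      + (if w = 3 \<and> odd m then 1 else 0))"
  have "covers 4 2 V (complete_edges (insert h (Y \<union> W))) (card W * (m * 4) + (m - card W) * (m * 3)
      + ((Suc (card W) choose 2) + m + (m - card W div 2 + 1) div 2 + (if card W = 3 \<and> odd m then 1 else 0)))"
    by (rule covers_large) (use Y W v in auto)
  then have "cost_ON2 X V 4 2 \<le> ?c"
    unfolding XU W(2) by (rule cost_ON2_le_of_covers[OF X(1)])
  moreover have "int ?c = int (card X choose 2)
    + (int (card V choose 2) - int (card V) * int w + (int w + 1) div 2 + 1) div 2
    + (if w = 3 \<and> odd m then 1 else 0)"
  proof -
    obtain d where d: "m = w + d" using v(2) le_Suc_ex by blast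
    have V2: "card V choose 2 = m * (2 * m + 1)"
      using two_times_choose_two[of "2 * m + 1"] v(1) by simp
    have X2: "2 * (card X choose 2) = (2 * m + 1 + w) * (2 * m + w)"
      using two_times_choose_two[of "2 * m + 1 + w"] X(3) v(1) by simp
    have W2: "2 * (Suc w choose 2) = (w + 1) * w"
      using two_times_choose_two[of "Suc w"] by simp
    have "card X choose 2 = (Suc w choose 2) + 2 * m * w + m + 2 * m * m"
      using X2 W2 by (simp add: algebra_simps)
    then have X3: "int (card X choose 2) = int (Suc w choose 2) + 2 * int m * int w + int m + 2 * int m * int m"
      by simp
    \<comment> \<open>The summand \<open>2 * m * d\<close> passes through the rounding and becomes
      the excess of the \<open>m * d\<close> cherries; the rest is the rounded excess of
      \<open>covers_center\<close>.\<close>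
    have "int (card V choose 2) - int (card V) * int w + (int w + 1) div 2 + 1
        = (int d + (int w + 1) div 2 + 1) + (int m * int d) * 2"
      unfolding V2 unfolding v(1) d by (simp add: algebra_simps)
    then have "(int (card V choose 2) - int (card V) * int w + (int w + 1) div 2 + 1) div 2
        = (int d + (int w + 1) div 2 + 1) div 2 + int m * int d"
      by simp
    moreover have "int (m - w div 2 + 1) = int d + (int w + 1) div 2 + 1"
      unfolding d by linarith
    then have "int ((m - w div 2 + 1) div 2) = (int d + (int w + 1) div 2 + 1) div 2"
      by (simp only: zdiv_int of_nat_numeral)
    ultimately show ?thesis
      unfolding X3 by (simp add: d algebra_simps)
  qed
  ultimately show ?thesis by linarith
qed

text \<open>Dividing by 4 and rounding up once, or halving and rounding up twice, gives the same
  integer, so \<open>grooming_cost_lower\<close> yields exactly the nested ceiling.\<close>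

lemma cost_ON2_large_ge:
  fixes X V :: "'a set"
  assumes X: "finite X" "V \<subseteq> X" "card X = card V + w" and v: "odd (card V)"
  shows "int (card X choose 2)
    + (int (card V choose 2) - int (card V) * int w + (int w + 1) div 2 + 1) div 2
    + (if w = 3 \<and> card V mod 4 = 3 then 1 else 0) \<le> int (cost_ON2 X V 4 2)"
proof -
  define W where "W = X - V"
  have fV: "finite V" using X finite_subset by blast
  have W: "finite W" "card W = w" "V \<inter> W = {}" "V \<union> W = X"
    using X fV by (auto simp: W_def card_Diff_subset)
  interpret two_parts V W by unfold_locales (use fV W in auto)
  obtain P where P: "grooming2 (V \<union> W) V 4 2 P" "grooming_cost P = cost_ON2 X V 4 2"
    using cost_ON2_attained[of 4 2 X V] unfolding W(4) by auto
  define N where "N = int (card V choose 2) - int (card V) * int w"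
  have low: "2 * N + int w \<le> 4 * (int (cost_ON2 X V 4 2) - int (card X choose 2))"
    using grooming_cost_lower[OF P(1) v] unfolding W(2) P(2) X(3) N_def by (simp add: algebra_simps)
  show ?thesis
  proof (cases "w = 3 \<and> card V mod 4 = 3")
    case True
    then have "2 * N + 6 \<le> 4 * (int (cost_ON2 X V 4 2) - int (card X choose 2))"
      using grooming_cost_lower_three[OF P(1) v] unfolding W(2) P(2) X(3) N_def by (simp add: algebra_simps)
    \<comment> \<open>Only for even \<open>N\<close> does the total defect 6 instead of 3 change the
      rounded bound; this is where \<open>card V mod 4 = 3\<close> enters.\<close>
    moreover have "even N"
    proof -
      obtain q where "card V = 4 * q + 3" using True by (metis mult_div_mod_eq)
      then have "card V choose 2 = (4 * q + 3) * (2 * q + 1)"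
        using two_times_choose_two[of "4 * q + 3"] by (simp add: algebra_simps)
      then show ?thesis using True v by (simp add: N_def)
    qed
    ultimately show ?thesis using True unfolding N_def[symmetric] by simp presburger
  next
    case False
    then show ?thesis using low unfolding N_def[symmetric] by simp presburger
  qed
qed

theorem theorem4p2:
  fixes X V :: "'a set" and v w :: nat
  assumes "finite X" and "V \<subseteq> X" and "card V = v" and "card X = v + w"
    and "v + w \<ge> 5" and "odd v"
  shows "(int v \<le> 2 * int w - 1 \<longrightarrow> cost_ON2 X V 4 2 = cost_ON X 4)
    \<and> (int v \<ge> 2 * int w + 1 \<longrightarrow>
         int (cost_ON2 X V 4 2) =
           int ((v + w) choose 2)
           + \<lceil>(real (v choose 2) - real v * real w + real_of_int \<lceil>real w / 2\<rceil>) / 2\<rceil>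
           + (if w = 3 \<and> v mod 4 = 3 then 1 else 0))"
proof (intro conjI impI)
  assume "int v \<le> 2 * int w - 1"
  then have "cost_ON2 X V 4 2 \<le> card X choose 2"
    using assms by (intro cost_ON2_small) auto
  then show "cost_ON2 X V 4 2 = cost_ON X 4"
    using choose_two_le_cost_ON[OF assms(1)] cost_ON_le_cost_ON2[of 4 2 X V] by simp
next
  assume large: "int v \<ge> 2 * int w + 1"
  obtain m where m: "v = 2 * m + 1" using assms(6) by (elim oddE)
  have "v mod 4 = 3 \<longleftrightarrow> odd m" unfolding m by presburger
  then show "int (cost_ON2 X V 4 2) = int ((v + w) choose 2)
      + \<lceil>(real (v choose 2) - real v * real w + real_of_int \<lceil>real w / 2\<rceil>) / 2\<rceil>
      + (if w = 3 \<and> v mod 4 = 3 then 1 else 0)"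
    using cost_ON2_large_le[of X V w m] cost_ON2_large_ge[of X V w] assms m large
    unfolding ceiling_excess by simp
qed

end
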